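(* Let $\{A_x\}_{x\in(0,\infty)}$ be a collection of finite sets with $A_i\subset A_j$ whenever $i\le j$, such that $A:=\bigcup_x A_x$ is infinite. Let $n:A\to\mathbb N$ be a function, and for integers $\delta\ge1$ put $\pi(x,\delta):=\#\{a\in A_x: n(a)\equiv 0 \pmod\delta\}$. Let $r\ge1$ be any integer. (1) Assume: (U1) there exists $\beta>0$ such that $|n(a)|<x^\beta$ for every $a\in A_x$ and every $x>0$; and (U2) there is a positive real number $c_0$ such that $\pi(x,\delta)\ll\frac{1}{\phi(\delta)}\#A_x$ for all integers $1\le\delta\le x^{c_0}$ and for all $x>0$, where $c_0$ and the implied constant are independent of $A$. Then $$\sum_{a\in A_x}d(n(a))^r\ll \#A_x\cdot(\log x)^{2^r-1},$$ where the implied constant is independent of $A$ and $x$. (2) Assume: (L) there is a positive real number $c_1$ such that $\pi(x,\delta)\gg\frac1\delta\#A_x$ for all integers $1\le\delta\le x^{c_1}$ and for all sufficiently large $x$, where $c_1$ and the implied constant are independent of $A$. Then for all sufficiently large $x$, $$\sum_{a\in A_x}d(n(a))^r\gg \#A_x\cdot(\log x)^{2^r-1},$$ where the implied constant is independent of $A$ and $x$.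
   Context: $d(m)$ is the number of positive divisors of $m$, $\phi$ is Euler's totient function, $\mathbb N=\{1,2,3,\dots\}$.
   Formalization: In (1) the bound is proved for x ≥ x₀, for every fixed x₀ > 1, with implied constant depending on x₀, r, β, c₀ and the constant in (U2): it fails as x → 1⁺ (if some n(a) = 1, log x → 0 but the sum is at least 1), and dependence on β is unavoidable. *)

theory Defs
  imports Complex_Main "HOL-Number_Theory.Number_Theory"
begin

definition num_divisors :: "nat \<Rightarrow> nat" where
  "num_divisors m = card {k. k dvd m}"

(* Values of A at nonpositive arguments and of n outside the union are irrelevant.
   The family only enters through x > 0. *)
definition admissible_family :: "(real \<Rightarrow> 'a set) \<Rightarrow> ('a \<Rightarrow> nat) \<Rightarrow> bool" where
  "admissible_family A n \<longleftrightarrow>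
     (\<forall>x>0. finite (A x)) \<and>
     (\<forall>i>0. \<forall>j\<ge>i. A i \<subseteq> A j) \<and>
     infinite (\<Union>x\<in>{0<..}. A x) \<and>
     (\<forall>a\<in>(\<Union>x\<in>{0<..}. A x). n a \<ge> 1)"

definition pi_count :: "(real \<Rightarrow> 'a set) \<Rightarrow> ('a \<Rightarrow> nat) \<Rightarrow> real \<Rightarrow> nat \<Rightarrow> nat" where
  "pi_count A n x \<delta> = card {a \<in> A x. [n a = 0] (mod \<delta>)}"

(* In U2 and L the implied constant is the explicit parameter K. That c and K do not
   depend on the family is expressed by quantifying them before A and n. *)
definition U1 :: "real \<Rightarrow> (real \<Rightarrow> 'a set) \<Rightarrow> ('a \<Rightarrow> nat) \<Rightarrow> bool" where
  "U1 \<beta> A n \<longleftrightarrow> (\<forall>x>0. \<forall>a\<in>A x. \<bar>real (n a)\<bar> < x powr \<beta>)"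

definition U2 :: "real \<Rightarrow> real \<Rightarrow> (real \<Rightarrow> 'a set) \<Rightarrow> ('a \<Rightarrow> nat) \<Rightarrow> bool" where
  "U2 c K A n \<longleftrightarrow>
     (\<forall>x>0. \<forall>\<delta>\<ge>1. real \<delta> \<le> x powr c \<longrightarrow>
        real (pi_count A n x \<delta>) \<le> K * (1 / real (totient \<delta>) * real (card (A x))))"

definition L :: "real \<Rightarrow> real \<Rightarrow> (real \<Rightarrow> 'a set) \<Rightarrow> ('a \<Rightarrow> nat) \<Rightarrow> bool" where
  "L c K A n \<longleftrightarrow>
     (\<forall>\<^sub>F x in at_top. \<forall>\<delta>\<ge>1. real \<delta> \<le> x powr c \<longrightarrow>
        real (pi_count A n x \<delta>) \<ge> K * (1 / real \<delta> * real (card (A x))))"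

end

theory Submission
  imports Defs "HOL-Analysis.Harmonic_Numbers"
begin

text \<open>Write \<open>k = 2\<^sup>r - 1\<close>. For the lower bound, \<open>d(n)\<^sup>r\<close> is at least the sum of \<open>k\<^bsup>\<omega>(\<delta>)\<^esup>\<close> over the squarefree
  \<open>\<delta> | n\<close> with \<open>\<delta> \<le> x\<^bsup>c\<^esup>\<close>, and the sum of \<open>k\<^bsup>\<omega>(\<delta>)\<^esup>/\<delta>\<close> over such \<open>\<delta>\<close> has order \<open>(ln x)\<^bsup>k\<^esup>\<close>: it suffices to take
  \<open>\<delta>\<close> composed of primes up to a small power of \<open>x\<close>, where Rankin's trick makes the \<open>\<delta> > x\<^bsup>c\<^esup>\<close>
  negligible in the Euler product.

  For the upper bound, let \<open>m\<close> be the largest product of an initial segment of the primes of \<open>n\<close>, in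
  increasing order, with \<open>m \<le> x\<^bsup>c\<^esup>\<close>, and let \<open>p\<close> be the next prime. If \<open>p\<close> is about \<open>x\<^bsup>1/s\<^esup>\<close>, then \<open>d(n)\<^sup>r\<close> exceeds
  \<open>d(m)\<^sup>r\<close> by a factor exponential in \<open>s\<close> only, and Rankin's trick for the \<open>x\<^bsup>1/s\<^esup>\<close>-smooth number \<open>m\<close> regains
  more than that. The twist \<open>m\<^bsup>\<eta>\<^esup> d(m)\<^sup>r\<close> is a divisor sum of a function close to \<open>k\<^bsup>\<omega>\<^esup>\<close>, all
  of whose terms have \<open>\<delta> \<le> m \<le> x\<^bsup>c\<^esup>\<close>, so hypothesis U2 applies and gives the exponent \<open>k\<close>
  instead of \<open>2\<^sup>r\<close>.\<close>

subsection \<open>Divisors and factorisations\<close>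

lemma prod_prime_factors_superset:
  fixes F :: "nat \<Rightarrow> nat \<Rightarrow> 'a::comm_monoid_mult"
  assumes "finite P" "\<And>p. p \<in> P \<Longrightarrow> prime p" "prime_factors n \<subseteq> P" "\<And>p. F p 0 = 1"
  shows "(\<Prod>p\<in>prime_factors n. F p (multiplicity p n)) = (\<Prod>p\<in>P. F p (multiplicity p n))"
  using assms by (intro prod.mono_neutral_left) (auto simp: prime_factors_multiplicity)

text \<open>Expanding the product gives a sum over exponent vectors on \<open>P\<close>. By unique
  factorisation distinct \<open>n\<close> in \<open>S\<close> have distinct vectors, and the vectors
  that do not come from \<open>S\<close> contribute nonnegative terms.\<close>

lemma sum_multiplicative_le_prod:
  fixes F :: "nat \<Rightarrow> nat \<Rightarrow> real"
  assumes P: "finite P" "\<And>p. p \<in> P \<Longrightarrow> prime p"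
    and F0: "\<And>p. F p 0 = 1" and F: "\<And>p v. prime p \<Longrightarrow> F p v \<ge> 0"
    and S: "\<And>n. n \<in> S \<Longrightarrow> n > 0 \<and> prime_factors n \<subseteq> P \<and> (\<forall>p\<in>P. multiplicity p n \<le> V p)"
  shows "(\<Sum>n\<in>S. \<Prod>p\<in>prime_factors n. F p (multiplicity p n)) \<le> (\<Prod>p\<in>P. \<Sum>v\<le>V p. F p v)"
proof -
  define h where "h = (\<lambda>n. restrict (\<lambda>p. multiplicity p n) P)"
  have inj: "inj_on h S"
  proof (rule inj_onI)
    fix m n assume mn: "m \<in> S" "n \<in> S" "h m = h n"
    have eq: "multiplicity p m = multiplicity p n" if "prime p" for p
    proof (cases "p \<in> P")
      case True
      then show ?thesis using fun_cong[OF mn(3), of p] by (simp add: h_def)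
    next
      case False
      then have "p \<notin> prime_factors m" "p \<notin> prime_factors n" using S mn by blast+
      then show ?thesis using that by (auto simp: prime_factors_multiplicity)
    qed
    have "m > 0" "n > 0" using S mn(1,2) by blast+
    then show "m = n" using eq by (rule multiplicity_eq_nat)
  qed
  have "(\<Sum>n\<in>S. \<Prod>p\<in>prime_factors n. F p (multiplicity p n)) = (\<Sum>n\<in>S. \<Prod>p\<in>P. F p (h n p))"
  proof (rule sum.cong[OF refl])
    fix n assume "n \<in> S"
    then have "prime_factors n \<subseteq> P" using S by blast
    then have "(\<Prod>p\<in>prime_factors n. F p (multiplicity p n)) = (\<Prod>p\<in>P. F p (multiplicity p n))"
      by (intro prod_prime_factors_superset P F0)
    also have "\<dots> = (\<Prod>p\<in>P. F p (h n p))" by (intro prod.cong) (auto simp: h_def)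
    finally show "(\<Prod>p\<in>prime_factors n. F p (multiplicity p n)) = (\<Prod>p\<in>P. F p (h n p))" .
  qed
  also have "\<dots> = (\<Sum>g\<in>h ` S. \<Prod>p\<in>P. F p (g p))"
    using inj by (simp add: sum.reindex)
  also have "\<dots> \<le> (\<Sum>g\<in>PiE P (\<lambda>p. {..V p}). \<Prod>p\<in>P. F p (g p))"
    using S P by (intro sum_mono2 finite_PiE prod_nonneg F) (auto simp: h_def)
  also have "\<dots> = (\<Prod>p\<in>P. \<Sum>v\<le>V p. F p v)"
    using P by (subst prod_sum_PiE) auto
  finally show ?thesis .
qed

text \<open>The same expansion read in the other direction: an exponent vector bounded by the
  multiplicities of \<open>m\<close> is the factorisation of a divisor of \<open>m\<close>, and
  different vectors give different divisors.\<close>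

lemma prod_le_sum_divisors_multiplicative:
  fixes F :: "nat \<Rightarrow> nat \<Rightarrow> real"
  assumes m: "m > 0" and F0: "\<And>p. F p 0 = 1" and F: "\<And>p v. prime p \<Longrightarrow> F p v \<ge> 0"
  shows "(\<Prod>p\<in>prime_factors m. \<Sum>v\<le>multiplicity p m. F p v)
         \<le> (\<Sum>d | d dvd m. \<Prod>p\<in>prime_factors d. F p (multiplicity p d))"
proof -
  define P where "P = prime_factors m"
  define G where "G = PiE P (\<lambda>p. {..multiplicity p m})"
  define h where "h = (\<lambda>g. \<Prod>p\<in>P. p ^ g p :: nat)"
  have P: "finite P" "\<And>p. p \<in> P \<Longrightarrow> prime p" by (auto simp: P_def)
  have mult: "multiplicity p (h g) = (if p \<in> P then g p else 0)" if "prime p" for p g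
    unfolding h_def using P that by (subst multiplicity_prod_prime_powers) auto
  have pos: "h g > 0" for g
    unfolding h_def using P by (intro prod_pos) (auto simp: prime_gt_0_nat)
  have sub: "prime_factors (h g) \<subseteq> P" for g
    using mult by (auto simp: prime_factors_multiplicity split: if_splits)
  have inj: "inj_on h G"
  proof (rule inj_onI)
    fix f g assume fg: "f \<in> G" "g \<in> G" "h f = h g"
    show "f = g"
    proof
      fix p show "f p = g p"
      proof (cases "p \<in> P")
        case True
        with P mult[of p f] mult[of p g] fg show ?thesis by simp
      next
        case False
        with fg show ?thesis by (auto simp: G_def PiE_def extensional_def)
      qed
    qed
  qed
  have dvd: "h g dvd m" if "g \<in> G" for g
  proof (rule multiplicity_le_imp_dvd)
    show "h g \<noteq> 0" using pos[of g] by simp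
    fix p :: nat assume "prime p"
    then show "multiplicity p (h g) \<le> multiplicity p m"
      using that mult[of p g] by (auto simp: G_def)
  qed
  have "(\<Prod>p\<in>P. \<Sum>v\<le>multiplicity p m. F p v) = (\<Sum>g\<in>G. \<Prod>p\<in>P. F p (g p))"
    unfolding G_def using P by (subst prod_sum_PiE) auto
  also have "\<dots> = (\<Sum>g\<in>G. \<Prod>p\<in>prime_factors (h g). F p (multiplicity p (h g)))"
  proof (rule sum.cong[OF refl])
    fix g
    show "(\<Prod>p\<in>P. F p (g p)) = (\<Prod>p\<in>prime_factors (h g). F p (multiplicity p (h g)))"
      using P sub mult by (subst prod_prime_factors_superset[where P = P]) (auto simp: F0 intro!: prod.cong)
  qed
  also have "\<dots> = (\<Sum>d\<in>h ` G. \<Prod>p\<in>prime_factors d. F p (multiplicity p d))"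
    using inj by (simp add: sum.reindex)
  also have "\<dots> \<le> (\<Sum>d | d dvd m. \<Prod>p\<in>prime_factors d. F p (multiplicity p d))"
    using m dvd by (intro sum_mono2 prod_nonneg F) auto
  finally show ?thesis by (simp add: P_def)
qed

section \<open>Bounds for the divisor function and splitting a number along its ordered
  primes\<close>

lemma num_divisors_pos: "n > 0 \<Longrightarrow> num_divisors n > 0"
  unfolding num_divisors_def by (auto simp: card_gt_0_iff)

lemma num_divisors_le_prod:
  assumes "n > 0"
  shows "real (num_divisors n) \<le> (\<Prod>p\<in>prime_factors n. real (multiplicity p n) + 1)"
proof -
  have "real (num_divisors n) = (\<Sum>d | d dvd n. \<Prod>p\<in>prime_factors d. 1)"
    by (simp add: num_divisors_def)
  also have "\<dots> \<le> (\<Prod>p\<in>prime_factors n. \<Sum>v\<le>multiplicity p n. 1)"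
  proof (rule sum_multiplicative_le_prod[where F = "\<lambda>_ _. 1"])
    fix d assume "d \<in> {d. d dvd n}"
    then have d: "d dvd n" by simp
    have "prime_factors d \<subseteq> prime_factors n"
      using assms d by (intro dvd_prime_factors) auto
    moreover have "multiplicity p d \<le> multiplicity p n" for p
      using assms d by (intro dvd_imp_multiplicity_le) auto
    ultimately show "d > 0 \<and> prime_factors d \<subseteq> prime_factors n \<and>
        (\<forall>p\<in>prime_factors n. multiplicity p d \<le> multiplicity p n)"
      using assms d dvd_pos_nat by blast
  qed (auto intro: in_prime_factors_imp_prime)
  finally show ?thesis by (simp add: add.commute)
qed

text \<open>Each divisor of \<open>a * b\<close> is a divisor of \<open>a\<close> times a divisor of
  \<open>b\<close>, so multiplication maps the pairs of divisors onto the divisors of the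
  product.\<close>

lemma num_divisors_mult_le: "num_divisors (a * b) \<le> num_divisors a * num_divisors b"
proof (cases "a * b = 0")
  case True
  \<comment> \<open>Every number divides 0, and \<open>card\<close> of an infinite set is 0.\<close>
  have "num_divisors 0 = 0" unfolding num_divisors_def by simp
  with True show ?thesis by auto
next
  case False
  have "{k. k dvd a * b} \<subseteq> (\<lambda>(x, y). x * y) ` ({k. k dvd a} \<times> {k. k dvd b})"
  proof
    fix k assume "k \<in> {k. k dvd a * b}"
    then obtain x y where "k = x * y" "x dvd a" "y dvd b"
      using division_decomp[of k a b] by auto
    then show "k \<in> (\<lambda>(x, y). x * y) ` ({k. k dvd a} \<times> {k. k dvd b})" by force
  qed
  then have "card {k. k dvd a * b} \<le> card ({k. k dvd a} \<times> {k. k dvd b})"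
    using False by (intro surj_card_le) auto
  then show ?thesis by (simp add: num_divisors_def card_cartesian_product)
qed

lemma num_divisors_prime: "prime p \<Longrightarrow> num_divisors p = 2"
proof -
  assume p: "prime p"
  then have "{k. k dvd p} = {1, p}" by (auto simp: prime_nat_iff)
  moreover have "p \<noteq> 1" using p by auto
  ultimately show ?thesis by (simp add: num_divisors_def)
qed

text \<open>Distinct subsets of \<open>T\<close> have distinct products, each of them a squarefree
  divisor of \<open>n\<close>.\<close>

lemma two_power_primes_le_num_divisors:
  assumes "n > 0" "T \<subseteq> prime_factors n"
  shows "2 ^ card T \<le> num_divisors n"
proof -
  have fin: "finite T" using assms finite_subset by blast
  have inj: "inj_on (\<lambda>X. \<Prod>X) (Pow T)"
    using assms fin finite_subset by (intro inj_on_Prod_primes) auto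
  have "\<Prod>X dvd n" if "X \<subseteq> T" for X
  proof -
    have "\<Prod>X dvd \<Prod>(prime_factors n)"
      using that assms by (intro prod_dvd_prod_subset) auto
    also have "\<dots> dvd (\<Prod>p\<in>prime_factors n. p ^ multiplicity p n)"
      by (intro prod_dvd_prod) (auto simp: prime_factors_multiplicity)
    also have "\<dots> = n" using assms by (subst prod_prime_factors) auto
    finally show ?thesis .
  qed
  then have "card ((\<lambda>X. \<Prod>X) ` Pow T) \<le> num_divisors n"
    unfolding num_divisors_def using assms by (intro card_mono) auto
  then show ?thesis using inj fin by (simp add: card_image card_Pow)
qed

text \<open>The witness \<open>t\<close> counts the prime factors of \<open>b\<close> with
  multiplicity: each one at most doubles the number of divisors and multiplies \<open>b\<close> by
  at least \<open>p\<close>.\<close>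

lemma num_divisors_rough:
  assumes "b > 0" "p > 0" "\<And>q. prime q \<Longrightarrow> q dvd b \<Longrightarrow> p \<le> q"
  shows "\<exists>t. num_divisors b \<le> 2 ^ t \<and> p ^ t \<le> b"
  using assms
proof (induction b rule: prime_divisors_induct)
  case zero
  then show ?case by simp
next
  case (unit x)
  then show ?case by (intro exI[of _ 0]) (auto simp: num_divisors_def)
next
  case (factor q x)
  then obtain t where t: "num_divisors x \<le> 2 ^ t" "p ^ t \<le> x" by fastforce
  have "num_divisors (q * x) \<le> 2 * 2 ^ t"
    using num_divisors_mult_le[of q x] num_divisors_prime[of q] factor(1) t(1) by simp
  moreover have "p * p ^ t \<le> q * x"
    using factor t by (intro mult_mono) auto
  ultimately show ?case by (intro exI[of _ "Suc t"]) simp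
qed

text \<open>Strip the largest prime \<open>q\<close> from \<open>n\<close>. If the cofactor still
  exceeds \<open>y\<close>, split the cofactor and put \<open>q\<close> into \<open>b\<close>;
  otherwise the cofactor is \<open>m\<close>, and both \<open>b\<close> and \<open>p\<close> are
  \<open>q\<close>.\<close>

lemma ordered_factor_split:
  fixes n :: nat and y :: real
  assumes "n > 0" "real n > y" "y \<ge> 1"
  shows "\<exists>m b p. n = m * b \<and> prime p \<and> p dvd b \<and> real m \<le> y \<and> y < real (m * p) \<and>
           (\<forall>q. prime q \<longrightarrow> q dvd m \<longrightarrow> q \<le> p) \<and> (\<forall>q. prime q \<longrightarrow> q dvd b \<longrightarrow> p \<le> q)"
  using assms
proof (induction n rule: less_induct)
  case (less n)
  have n1: "n > 1" using less.prems by linarith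
  define q where "q = Max (prime_factors n)"
  have ne: "prime_factors n \<noteq> {}" using n1 by (auto simp: prime_factorization_empty_iff)
  then have "q \<in> prime_factors n" unfolding q_def by (intro Max_in) auto
  then have q: "prime q" "q dvd n" by auto
  have qmax: "p \<le> q" if "prime p" "p dvd n" for p
    unfolding q_def using that less.prems by (intro Max_ge) (auto simp: prime_factors_dvd)
  obtain n' where n': "n = n' * q" using q by (metis dvd_def mult.commute)
  have n'0: "n' > 0" using n' n1 by (cases n') auto
  show ?case
  proof (cases "real n' > y")
    case True
    have "n' < n" using n' q n'0 prime_gt_1_nat[of q] by simp
    from less.IH[OF this n'0 True less.prems(3)] obtain m b p where
      *: "n' = m * b" "prime p" "p dvd b" "real m \<le> y" "y < real (m * p)"
        "\<forall>q. prime q \<longrightarrow> q dvd m \<longrightarrow> q \<le> p" "\<forall>q. prime q \<longrightarrow> q dvd b \<longrightarrow> p \<le> q" by blast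
    have "p \<le> q" using * n' by (intro qmax) auto
    then have "p \<le> u" if "prime u" "u dvd b * q" for u
    proof -
      have "u dvd b \<or> u = q" using that q by (auto simp: prime_dvd_mult_iff primes_dvd_imp_eq)
      then show ?thesis using that * \<open>p \<le> q\<close> by auto
    qed
    with * n' show ?thesis
      by (intro exI[of _ m] exI[of _ "b * q"] exI[of _ p]) auto
  next
    case False
    have "q \<le> u" if "prime u" "u dvd q" for u
      using that q primes_dvd_imp_eq by blast
    with False less.prems q n' qmax show ?thesis
      by (intro exI[of _ n'] exI[of _ q] exI[of _ q]) auto
  qed
qed

subsection \<open>Sums over primes\<close>

text \<open>The cutoff is given by its logarithm because it is later scaled: the level
  \<open>L / real s\<close> stands for the primes up to X^(1/s), where X = e^L.\<close>

definition log_primes :: "real \<Rightarrow> nat set" where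
  "log_primes l = {p. prime p \<and> ln (real p) \<le> l}"

lemma prime_log_primes: "p \<in> log_primes l \<Longrightarrow> prime p"
  by (simp add: log_primes_def)

lemma log_primes_gt_1: "p \<in> log_primes l \<Longrightarrow> real p \<ge> 2"
  using prime_log_primes[of p l] prime_ge_2_nat[of p] by simp

lemma log_primes_le_exp: "p \<in> log_primes l \<Longrightarrow> real p \<le> exp l"
proof -
  assume "p \<in> log_primes l"
  then have "real p > 0" "ln (real p) \<le> l"
    using log_primes_gt_1[of p l] by (auto simp: log_primes_def)
  then show ?thesis by (metis exp_le_cancel_iff exp_ln)
qed

lemma finite_log_primes: "finite (log_primes l)"
proof (rule finite_subset)
  show "log_primes l \<subseteq> {..nat \<lfloor>exp l\<rfloor>}"
    using log_primes_le_exp by (auto simp: le_nat_floor)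
qed simp

text \<open>One constant for all secondary terms in sums over primes. The exponent 3/2 is what
  remains of p^(-2) after a twist p^(2e) with e at most 1/4.\<close>

lemma sum_powr_three_halves_bounded:
  "\<exists>Z\<ge>0. \<forall>S. finite S \<longrightarrow> (\<Sum>n\<in>S. real n powr (-3/2)) \<le> Z"
proof -
  have "summable (\<lambda>n. real n powr (-3/2))" by (simp add: summable_real_powr_iff)
  then show ?thesis
    by (intro exI[of _ "\<Sum>n. real n powr (-3/2)"] conjI allI impI sum_le_suminf suminf_nonneg) auto
qed

lemma inverse_square_le_powr:
  assumes "n \<ge> (1::nat)"
  shows "1 / real n ^ 2 \<le> real n powr (-3/2)"
proof -
  have "1 / real n ^ 2 = real n powr (-2)"
    using assms by (simp add: powr_minus divide_inverse powr_numeral)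
  also have "\<dots> \<le> real n powr (-3/2)" using assms by (intro powr_mono) auto
  finally show ?thesis .
qed

section \<open>Estimates of Chebyshev and Mertens type\<close>

lemma sum_ln_prime_factors_le:
  assumes "n > (0::nat)"
  shows "(\<Sum>p\<in>prime_factors n. ln (real p)) \<le> ln (real n)"
proof -
  have "(\<Sum>p\<in>prime_factors n. ln (real p)) = ln (\<Prod>p\<in>prime_factors n. real p)"
    by (intro ln_prod[symmetric]) (auto intro: prime_gt_0_nat)
  also have "\<dots> \<le> ln (\<Prod>p\<in>prime_factors n. real (p ^ multiplicity p n))"
  proof (intro ln_mono prod_mono conjI prod_pos)
    fix p assume "p \<in> prime_factors n"
    then have p: "prime p" "multiplicity p n > 0" by (auto simp: prime_factors_multiplicity)
    then show "real p > 0" by (auto intro: prime_gt_0_nat)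
    show "real p \<le> real (p ^ multiplicity p n)"
      using p prime_gt_0_nat[of p] by (intro of_nat_mono self_le_power) auto
  qed auto
  also have "(\<Prod>p\<in>prime_factors n. real (p ^ multiplicity p n)) = real n"
    using assms by (simp only: of_nat_prod[symmetric]) (subst prod_prime_factors, auto)
  finally show ?thesis .
qed

text \<open>Double counting: up to N, the integer part of e^l, a prime p in the range has at least
  N/(2p) multiples, while each n up to N receives in total at most ln n, hence at most l, from its
  primes.\<close>

lemma sum_ln_over_primes_le:
  assumes "l \<ge> 0"
  shows "(\<Sum>p\<in>log_primes l. ln (real p) / real p) \<le> 2 * l"
proof -
  define N where "N = nat \<lfloor>exp l\<rfloor>"
  have N1: "N \<ge> 1" using assms by (simp add: N_def le_nat_floor)
  have Ne: "real N \<le> exp l" unfolding N_def by simp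
  have lnN: "ln (real N) \<le> l" using N1 Ne by (metis exp_gt_zero ln_exp ln_mono of_nat_0_less_iff less_le_trans zero_less_one)
  have pN: "p \<le> N" if "p \<in> log_primes l" for p
    using log_primes_le_exp[OF that] by (simp add: N_def le_nat_floor)
  have "real N * (\<Sum>p\<in>log_primes l. ln (real p) / real p) \<le>
        (\<Sum>p\<in>log_primes l. 2 * (ln (real p) * real (card {n\<in>{1..N}. p dvd n})))"
    unfolding sum_distrib_left
  proof (rule sum_mono)
    fix p assume p: "p \<in> log_primes l"
    then have p2: "real p \<ge> 2" by (rule log_primes_gt_1)
    have "card ((*) p ` {1..N div p}) \<le> card {n\<in>{1..N}. p dvd n}"
    proof (intro card_mono)
      show "(*) p ` {1..N div p} \<subseteq> {n\<in>{1..N}. p dvd n}"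
      proof
        fix n assume "n \<in> (*) p ` {1..N div p}"
        then obtain i where i: "n = p * i" "1 \<le> i" "i \<le> N div p" by fastforce
        have "p * i \<le> p * (N div p)" using i by simp
        also have "\<dots> \<le> N" by simp
        finally show "n \<in> {n\<in>{1..N}. p dvd n}" using i p2 by (cases "p = 0") auto
      qed
    qed auto
    then have c: "N div p \<le> card {n\<in>{1..N}. p dvd n}"
      using p2 by (subst (asm) card_image) (auto simp: inj_on_def)
    \<comment> \<open>Since p is at most N, the quotient is at least 1, so rounding down loses at
      most a factor 2.\<close>
    have "N div p \<ge> 1" using pN[OF p] p2 by (simp add: Suc_le_eq div_greater_zero_iff)
    have "N < p + p * (N div p)" using p2 by (intro dividend_less_times_div) auto
    then have "N \<le> p * (N div p + 1)" by simp
    also have "\<dots> \<le> p * (2 * (N div p))" using \<open>N div p \<ge> 1\<close> by (intro mult_le_mono2) simp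
    also have "\<dots> \<le> p * (2 * card {n\<in>{1..N}. p dvd n})" using c by simp
    finally have "real N \<le> real (p * (2 * card {n\<in>{1..N}. p dvd n}))"
      by (rule of_nat_mono)
    then have "real N / real p \<le> 2 * real (card {n\<in>{1..N}. p dvd n})"
      using p2 by (simp add: field_simps)
    then have "ln (real p) * (real N / real p) \<le> ln (real p) * (2 * real (card {n\<in>{1..N}. p dvd n}))"
      using p2 by (intro mult_left_mono) auto
    then show "real N * (ln (real p) / real p) \<le> 2 * (ln (real p) * real (card {n\<in>{1..N}. p dvd n}))"
      by (simp add: mult_ac)
  qed
  also have "\<dots> = 2 * (\<Sum>p\<in>log_primes l. \<Sum>n | n \<in> {1..N} \<and> p dvd n. ln (real p))"
    by (simp add: sum_distrib_left mult_ac)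
  also have "(\<Sum>p\<in>log_primes l. \<Sum>n | n \<in> {1..N} \<and> p dvd n. ln (real p)) =
      (\<Sum>n\<in>{1..N}. \<Sum>p | p \<in> log_primes l \<and> p dvd n. ln (real p))"
    by (rule sum.swap_restrict) (auto simp: finite_log_primes)
  also have "\<dots> \<le> (\<Sum>n\<in>{1..N}. l)"
  proof (rule sum_mono)
    fix n assume n: "n \<in> {1..N}"
    have "(\<Sum>p | p \<in> log_primes l \<and> p dvd n. ln (real p)) \<le> (\<Sum>p\<in>prime_factors n. ln (real p))"
      using n by (intro sum_mono2)
        (auto simp: prime_factors_dvd prime_log_primes dest!: prime_gt_0_nat)
    also have "\<dots> \<le> ln (real n)" using n by (intro sum_ln_prime_factors_le) auto
    also have "\<dots> \<le> ln (real N)" using n by (intro ln_mono) auto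
    finally show "(\<Sum>p | p \<in> log_primes l \<and> p dvd n. ln (real p)) \<le> l" using lnN by simp
  qed
  finally have "real N * (\<Sum>p\<in>log_primes l. ln (real p) / real p) \<le> real N * (2 * l)" by simp
  then show ?thesis using N1 by simp
qed

lemma sum_powr_le_inverse:
  assumes t: "t > 0"
  shows "(\<Sum>n=1..N. real n powr (-1-t)) \<le> 1 + 1 / t"
proof -
  \<comment> \<open>The bound is 1 plus the integral of x^(-1-t) from 1 to N, which telescopes under
    induction. With u = 1/(N+1), the step amounts to (1-u)^(-t) \<ge> 1 + tu.\<close>
  have "(\<Sum>n=1..N. real n powr (-1-t)) \<le> 1 + (1 - real N powr (-t)) / t" if "N \<ge> 1"
    using that
  proof (induction N rule: dec_induct)
    case base
    then show ?case by simp
  next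
    case (step N)
    have N: "real N > 0" using step by simp
    define u where "u = 1 / real (Suc N)"
    have u: "0 < u" "u < 1" "1 - u = real N / real (Suc N)" using N by (auto simp: u_def field_simps)
    have "u \<le> - ln (1 - u)" using u(1,2) ln_add_one_self_le_self2[of "-u"] by simp
    then have "t * u \<le> t * (- ln (1 - u))" using t by (intro mult_left_mono) auto
    then have "t * u \<le> - t * ln (1 - u)" by simp
    then have "1 + t * u \<le> exp (- t * ln (1 - u))" by (meson exp_ge_add_one_self exp_le_cancel_iff order_trans)
    also have "\<dots> = (1 - u) powr (-t)" using u(2) by (simp add: powr_def)
    also have "\<dots> = real N powr (-t) / real (Suc N) powr (-t)"
      using u N by (simp add: powr_divide)
    finally have "real (Suc N) powr (-t) * (1 + t * u) \<le> real N powr (-t)"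
      by (simp add: field_simps)
    moreover have "real (Suc N) powr (-1-t) = real (Suc N) powr (-t) * u"
      by (simp add: u_def powr_diff powr_minus field_simps)
    ultimately have "t * real (Suc N) powr (-1-t) \<le> real N powr (-t) - real (Suc N) powr (-t)"
      by (simp add: algebra_simps)
    then have "real (Suc N) powr (-1-t) \<le> (real N powr (-t) - real (Suc N) powr (-t)) / t"
      using t by (simp add: field_simps)
    then show ?case using step by (simp add: diff_divide_distrib)
  qed
  moreover have "(1 - real N powr (-t)) / t \<le> 1 / t" using t by (simp add: divide_right_mono)
  ultimately show ?thesis using t by (cases "N \<ge> 1") (auto simp: not_le)
qed

text \<open>Bounds a product of factors 1 + u below by the exponential of a sum, at the cost of
  squares whose sum over primes stays bounded. For u beyond 1 the exponent is negative.\<close>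

lemma exp_minus_square_le: "exp (u - u\<^sup>2) \<le> 1 + u" if "u \<ge> 0" for u :: real
proof (cases "u \<le> 1")
  case True
  have "exp (u - u\<^sup>2) \<le> exp (ln (1 + u))"
    using ln_one_plus_pos_lower_bound[OF that True] by simp
  then show ?thesis using that by simp
next
  case False
  then have "u - u\<^sup>2 \<le> 0" by (simp add: power2_eq_square)
  then have "exp (u - u\<^sup>2) \<le> exp 0" by (subst exp_le_cancel_iff)
  also have "\<dots> \<le> 1 + u" using that by simp
  finally show ?thesis .
qed

text \<open>Rankin's trick: at the exponent \<open>1 + 1/l\<close> the Euler product over the primes up to \<open>e\<^sup>l\<close>
  is at most \<open>1 + l\<close>, while \<open>1/p\<close> and \<open>1/p\<^bsup>1+1/l\<^esup>\<close> differ by at most \<open>ln p / (l p)\<close>.\<close>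

lemma sum_inverse_primes_le:
  "\<exists>C. \<forall>l\<ge>0. (\<Sum>p\<in>log_primes l. 1 / real p) \<le> ln (1 + l) + C"
proof -
  obtain Z where Z: "Z \<ge> 0" "\<And>S. finite S \<Longrightarrow> (\<Sum>n\<in>S. real n powr (-3/2)) \<le> Z"
    using sum_powr_three_halves_bounded by blast
  have "(\<Sum>p\<in>log_primes l. 1 / real p) \<le> ln (1 + l) + (2 + Z)" if "l \<ge> 0" for l
  proof (cases "l = 0")
    case True
    have "log_primes l = {}"
    proof -
      have False if "p \<in> log_primes l" for p
        using log_primes_gt_1[OF that] log_primes_le_exp[OF that] True by simp
      then show ?thesis by blast
    qed
    with True Z show ?thesis by simp
  next
    case False
    with that have l: "l > 0" by simp
    define P where "P = log_primes l"
    define s where "s = -1 - 1 / l"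
    have P: "finite P" "\<And>p. p \<in> P \<Longrightarrow> prime p" "\<And>p. p \<in> P \<Longrightarrow> real p \<ge> 2"
      using finite_log_primes prime_log_primes log_primes_gt_1 by (auto simp: P_def)
    have "exp (\<Sum>p\<in>P. real p powr s - (real p powr s)\<^sup>2) = (\<Prod>p\<in>P. exp (real p powr s - (real p powr s)\<^sup>2))"
      using P by (simp add: exp_sum)
    also have "\<dots> \<le> (\<Prod>p\<in>P. real p powr s + 1)"
      by (intro prod_mono conjI) (auto simp: add.commute intro!: exp_minus_square_le)
    also have "\<dots> = (\<Sum>X\<in>Pow P. \<Prod>p\<in>X. real p powr s)"
      using P by (subst prod_add) auto
    also have "\<dots> = (\<Sum>X\<in>Pow P. real (\<Prod>X) powr s)"
    proof (rule sum.cong[OF refl])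
      fix X assume "X \<in> Pow P"
      then have "\<And>p. p \<in> X \<Longrightarrow> real p \<ge> 0" "finite X" using P finite_subset by auto
      then show "(\<Prod>p\<in>X. real p powr s) = real (\<Prod>X) powr s"
        by (simp add: prod_powr_distrib)
    qed
    \<comment> \<open>Distinct sets of primes have distinct products, so the sum over subsets is
      part of a sum over all integers.\<close>
    also have "\<dots> = (\<Sum>n\<in>Prod ` Pow P. real n powr s)"
    proof -
      have "inj_on Prod (Pow P)" using P finite_subset by (intro inj_on_Prod_primes) auto
      then show ?thesis by (simp add: sum.reindex)
    qed
    also have "\<dots> \<le> (\<Sum>n=1..\<Prod>P. real n powr s)"
    proof (rule sum_mono2)
      show "Prod ` Pow P \<subseteq> {1..\<Prod>P}"
      proof
        fix n assume "n \<in> Prod ` Pow P"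
        then obtain X where X: "X \<subseteq> P" "n = \<Prod>X" by auto
        have "\<Prod>P > 0" using P prime_gt_0_nat by (intro prod_pos) auto
        moreover have "n dvd \<Prod>P" using X P by (auto intro: prod_dvd_prod_subset)
        ultimately show "n \<in> {1..\<Prod>P}" using dvd_imp_le dvd_pos_nat by (force simp: Suc_le_eq)
      qed
    qed auto
    also have "\<dots> \<le> 1 + 1 / (1 / l)"
      unfolding s_def using l by (intro sum_powr_le_inverse) auto
    finally have "ln (exp (\<Sum>p\<in>P. real p powr s - (real p powr s)\<^sup>2)) \<le> ln (1 + l)"
      by (intro ln_mono) auto
    then have 1: "(\<Sum>p\<in>P. real p powr s) \<le> ln (1 + l) + (\<Sum>p\<in>P. (real p powr s)\<^sup>2)"
      by (simp add: sum_subtractf)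
    have "(\<Sum>p\<in>P. (real p powr s)\<^sup>2) \<le> (\<Sum>p\<in>P. real p powr (-3/2))"
    proof (rule sum_mono)
      fix p assume "p \<in> P"
      have "(real p powr s)\<^sup>2 = real p powr (2 * s)" 
        by (simp add: power2_eq_square powr_add[symmetric])
      also have "\<dots> \<le> real p powr (-3/2)"
        using P(3)[OF \<open>p \<in> P\<close>] l by (intro powr_mono) (auto simp: s_def field_simps)
      finally show "(real p powr s)\<^sup>2 \<le> real p powr (-3/2)" .
    qed
    also have "\<dots> \<le> Z" using P by (intro Z)
    finally have 2: "(\<Sum>p\<in>P. (real p powr s)\<^sup>2) \<le> Z" .
    have "(\<Sum>p\<in>P. 1 / real p) \<le> (\<Sum>p\<in>P. real p powr s + (1 / l) * (ln (real p) / real p))"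
    proof (rule sum_mono)
      fix p assume "p \<in> P"
      then have p: "real p \<ge> 2" by (rule P)
      have "1 - ln (real p) / l \<le> exp (- ln (real p) / l)"
        using exp_ge_add_one_self[of "- ln (real p) / l"] by simp
      also have "\<dots> = real p powr (- 1 / l)" using p by (simp add: powr_def)
      also have "\<dots> = real p powr s * real p"
        using p by (simp add: s_def powr_diff powr_minus field_simps)
      finally show "1 / real p \<le> real p powr s + (1 / l) * (ln (real p) / real p)"
        using p l by (simp add: field_simps)
    qed
    also have "\<dots> = (\<Sum>p\<in>P. real p powr s) + (1 / l) * (\<Sum>p\<in>P. ln (real p) / real p)"
      by (simp add: sum.distrib sum_distrib_left)
    also have "(1 / l) * (\<Sum>p\<in>P. ln (real p) / real p) \<le> (1 / l) * (2 * l)"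
      unfolding P_def using l by (intro mult_left_mono sum_ln_over_primes_le) auto
    also have "\<dots> = 2" using l by simp
    finally show ?thesis using 1 2 by (simp add: P_def)
  qed
  then show ?thesis by blast
qed

lemma prod_prime_powers_real:
  assumes "n > (0::nat)"
  shows "(\<Prod>p\<in>prime_factors n. real p ^ multiplicity p n) = real n"
proof -
  have "(\<Prod>p\<in>prime_factors n. real p ^ multiplicity p n) = real (\<Prod>p\<in>prime_factors n. p ^ multiplicity p n)"
    by simp
  also have "\<dots> = real n" using assms by (subst prod_prime_factors) auto
  finally show ?thesis .
qed

lemma sum_multiplicative_le_prod_finite:
  fixes F :: "nat \<Rightarrow> nat \<Rightarrow> real"
  assumes P: "finite P" "\<And>p. p \<in> P \<Longrightarrow> prime p"
    and F0: "\<And>p. F p 0 = 1" and F: "\<And>p v. prime p \<Longrightarrow> F p v \<ge> 0"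
    and S: "finite S" "\<And>n. n \<in> S \<Longrightarrow> n > 0 \<and> prime_factors n \<subseteq> P"
    and B: "\<And>p V. p \<in> P \<Longrightarrow> (\<Sum>v\<le>V. F p v) \<le> B p"
  shows "(\<Sum>n\<in>S. \<Prod>p\<in>prime_factors n. F p (multiplicity p n)) \<le> (\<Prod>p\<in>P. B p)"
proof -
  \<comment> \<open>As \<open>S\<close> is finite, summing the multiplicities over it gives a single
    cap valid for every member.\<close>
  define V where "V = (\<lambda>p. \<Sum>n\<in>S. multiplicity p n)"
  have "(\<Sum>n\<in>S. \<Prod>p\<in>prime_factors n. F p (multiplicity p n)) \<le> (\<Prod>p\<in>P. \<Sum>v\<le>V p. F p v)"
    using P F0 F
  proof (rule sum_multiplicative_le_prod)
    fix n assume "n \<in> S"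
    then show "n > 0 \<and> prime_factors n \<subseteq> P \<and> (\<forall>p\<in>P. multiplicity p n \<le> V p)"
      using S unfolding V_def by (auto intro!: member_le_sum)
  qed
  also have "\<dots> \<le> (\<Prod>p\<in>P. B p)" by (intro prod_mono conjI sum_nonneg F B P)
  finally show ?thesis .
qed

text \<open>Euler's argument: all n up to e^l are products of primes up to e^l, so the harmonic sum,
  which is at least l, is bounded by the product of the geometric series of these primes. Taking
  logarithms leaves the sum of 1/p and a bounded sum of squares.\<close>

lemma sum_inverse_primes_ge:
  "\<exists>C. \<forall>l>0. (\<Sum>p\<in>log_primes l. 1 / real p) \<ge> ln l - C"
proof -
  obtain Z where Z: "Z \<ge> 0" "\<And>S. finite S \<Longrightarrow> (\<Sum>n\<in>S. real n powr (-3/2)) \<le> Z"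
    using sum_powr_three_halves_bounded by blast
  have "(\<Sum>p\<in>log_primes l. 1 / real p) \<ge> ln l - 2 * Z" if l: "l > 0" for l
  proof -
    define N where "N = nat \<lfloor>exp l\<rfloor>"
    define P where "P = log_primes l"
    have P: "finite P" "\<And>p. p \<in> P \<Longrightarrow> prime p" "\<And>p. p \<in> P \<Longrightarrow> real p \<ge> 2"
      using finite_log_primes prime_log_primes log_primes_gt_1 by (auto simp: P_def)
    \<comment> \<open>Rounding down gives only e^l \<le> N + 1, which is enough because
      \<open>harm N\<close> is at least ln (N + 1).\<close>
    have "real N = of_int \<lfloor>exp l\<rfloor>" unfolding N_def by simp
    then have "exp l \<le> real N + 1" by linarith
    then have "l \<le> ln (real N + 1)" using l by (subst ln_ge_iff) auto
    also have "\<dots> \<le> harm N" by (rule ln_le_harm)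
    also have "\<dots> = (\<Sum>n\<in>{1..N}. \<Prod>p\<in>prime_factors n. (1 / real p) ^ multiplicity p n)"
      unfolding harm_def
    proof (rule sum.cong[OF refl])
      fix n assume "n \<in> {1..N}"
      then have "inverse (real n) = inverse (\<Prod>p\<in>prime_factors n. real p ^ multiplicity p n)"
        by (subst prod_prime_powers_real) auto
      then show "inverse (real n) = (\<Prod>p\<in>prime_factors n. (1 / real p) ^ multiplicity p n)"
        by (simp add: power_inverse prod_inversef divide_inverse flip: prod_inversef)
    qed
    also have "\<dots> \<le> (\<Prod>p\<in>P. exp (1 / real p + 2 * (1 / real p)\<^sup>2))"
      using P(1,2)
    proof (rule sum_multiplicative_le_prod_finite)
      fix n assume n: "n \<in> {1..N}"
      have "p \<in> P" if "p \<in> prime_factors n" for p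
      proof -
        from that have p: "prime p" "p dvd n" by auto
        then have "p \<le> N" using n dvd_imp_le[of p n] by auto
        then have "real p \<le> real N" by simp
        also have "\<dots> \<le> exp l" unfolding N_def by simp
        finally have "ln (real p) \<le> l"
          using prime_gt_0_nat[OF p(1)] by (metis exp_gt_zero ln_exp ln_le_cancel_iff of_nat_0_less_iff)
        then show ?thesis using p by (simp add: P_def log_primes_def)
      qed
      then show "n > 0 \<and> prime_factors n \<subseteq> P" using n by auto
    next
      fix p V assume "p \<in> P"
      then have p: "real p \<ge> 2" by (rule P)
      define x where "x = 1 / real p"
      have x: "0 < x" "x \<le> 1/2" using p by (auto simp: x_def field_simps)
      have "(\<Sum>v\<le>V. x ^ v) \<le> 1 / (1 - x)"
      proof -
        have "(1 - x) * (\<Sum>v\<le>V. x ^ v) = 1 - x ^ Suc V" by (rule sum_gp_basic)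
        also have "\<dots> \<le> 1" using x by simp
        finally show ?thesis using x by (simp add: field_simps)
      qed
      also have "\<dots> = exp (- ln (1 - x))" using x by (simp add: exp_minus inverse_eq_divide)
      also have "\<dots> \<le> exp (x + 2 * x\<^sup>2)"
        using x ln_one_minus_pos_lower_bound[of x] by simp
      finally show "(\<Sum>v\<le>V. (1 / real p) ^ v) \<le> exp (1 / real p + 2 * (1 / real p)\<^sup>2)"
        by (simp add: x_def)
    qed auto
    also have "\<dots> = exp (\<Sum>p\<in>P. 1 / real p + 2 * (1 / real p)\<^sup>2)" using P by (simp add: exp_sum)
    finally have "ln l \<le> (\<Sum>p\<in>P. 1 / real p + 2 * (1 / real p)\<^sup>2)"
      using l by (metis ln_exp ln_mono)
    also have "\<dots> = (\<Sum>p\<in>P. 1 / real p) + 2 * (\<Sum>p\<in>P. 1 / real p ^ 2)"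
      by (simp add: sum.distrib sum_distrib_left power_divide)
    also have "(\<Sum>p\<in>P. 1 / real p ^ 2) \<le> (\<Sum>p\<in>P. real p powr (-3/2))"
      using P(3) by (intro sum_mono inverse_square_le_powr) (force)
    also have "\<dots> \<le> Z" using P by (intro Z)
    finally show ?thesis by (simp add: P_def)
  qed
  then show ?thesis by blast
qed

subsection \<open>The lower bound\<close>

text \<open>Makes p^e = 1 + O(e ln p) explicit when e ln p is bounded; it is a rearrangement of (1 -
  u) e^u \<le> 1.\<close>

lemma exp_le_one_plus_mult:
  fixes u :: real
  assumes "0 \<le> u" "u \<le> b"
  shows "exp u \<le> 1 + u * exp b"
proof -
  have "(1 - u) * exp u \<le> exp (- u) * exp u"
    using exp_ge_add_one_self[of "- u"] by (intro mult_right_mono) auto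
  then have "exp u \<le> 1 + u * exp u" by (simp add: exp_minus algebra_simps)
  also have "u * exp u \<le> u * exp b" using assms by (intro mult_left_mono) auto
  finally show ?thesis by simp
qed

lemma prod_one_plus_eq_sum_subsets:
  fixes f :: "'a \<Rightarrow> 'b::comm_semiring_1"
  assumes "finite P"
  shows "(\<Prod>p\<in>P. 1 + f p) = (\<Sum>X\<in>Pow P. \<Prod>p\<in>X. f p)"
  using prod_add[OF assms, of f "\<lambda>_. 1"] by (simp add: add.commute)

text \<open>Squarefree numbers appear as sets of primes, so the sum without size restriction is the
  product T of 1 + k/p. For sets with product beyond e^(sl), inserting the factor (product)^(1/l)
  gains e^(-s) and inflates T by at most e^(2ke), so they carry at most half of T.\<close>

lemma sum_squarefree_ge:
  fixes k :: nat
  shows "\<exists>D>0. \<exists>s>0. \<forall>l>0.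
    D * l ^ k \<le> (\<Sum>X | X \<subseteq> log_primes l \<and> real (\<Prod>X) \<le> exp (s * l). real (k ^ card X) / real (\<Prod>X))"
proof -
  obtain Z where Z: "Z \<ge> 0" "\<And>S. finite S \<Longrightarrow> (\<Sum>n\<in>S. real n powr (-3/2)) \<le> Z"
    using sum_powr_three_halves_bounded by blast
  obtain C where C: "\<And>l. l > 0 \<Longrightarrow> (\<Sum>p\<in>log_primes l. 1 / real p) \<ge> ln l - C"
    using sum_inverse_primes_ge by blast
  \<comment> \<open>One more than the exponent 2ke lost to the Rankin factor, so that the tail is at
    most T/e. The constant \<open>D\<close> is half of the lower bound for T / l^k, because half of
    T is given up to the tail.\<close>
  define s where "s = 2 * (real k * exp 1) + 1"
  define D where "D = exp (- real k * C - real k ^ 2 * Z) / 2"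
  have "D * l ^ k \<le> (\<Sum>X | X \<subseteq> log_primes l \<and> real (\<Prod>X) \<le> exp (s * l). real (k ^ card X) / real (\<Prod>X))"
    if l: "l > 0" for l
  proof -
    define P where "P = log_primes l"
    define w where "w = (\<lambda>X. real (k ^ card X) / real (\<Prod>X))"
    define T where "T = (\<Prod>p\<in>P. 1 + real k / real p)"
    have P: "finite P" "\<And>p. p \<in> P \<Longrightarrow> prime p" "\<And>p. p \<in> P \<Longrightarrow> real p \<ge> 2"
      using finite_log_primes prime_log_primes log_primes_gt_1 by (auto simp: P_def)
    have w: "w X = (\<Prod>p\<in>X. real k / real p)" for X
      by (simp add: w_def prod_dividef)
    have w0: "w X \<ge> 0" for X by (auto simp: w_def intro!: divide_nonneg_nonneg prod_nonneg)
    have T: "T = (\<Sum>X\<in>Pow P. w X)"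
      unfolding T_def using P by (simp add: prod_one_plus_eq_sum_subsets w)
    have "(\<Sum>X\<in>{X\<in>Pow P. real (\<Prod>X) > exp (s * l)}. w X)
        \<le> (\<Sum>X\<in>{X\<in>Pow P. real (\<Prod>X) > exp (s * l)}. exp (-s) * (real (\<Prod>X) powr (1 / l) * w X))"
    proof (rule sum_mono)
      fix X assume X: "X \<in> {X\<in>Pow P. real (\<Prod>X) > exp (s * l)}"
      have "exp s = exp (s * l) powr (1 / l)" using l by (simp add: powr_def)
      also have "\<dots> \<le> real (\<Prod>X) powr (1 / l)" using X l by (intro powr_mono2) auto
      finally have "1 \<le> exp (-s) * real (\<Prod>X) powr (1 / l)"
        by (simp add: exp_minus field_simps)
      then show "w X \<le> exp (-s) * (real (\<Prod>X) powr (1 / l) * w X)"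
        using mult_right_mono[OF _ w0[of X], of 1 "exp (-s) * real (\<Prod>X) powr (1 / l)"]
        by (simp add: mult_ac)
    qed
    also have "\<dots> \<le> (\<Sum>X\<in>Pow P. exp (-s) * (real (\<Prod>X) powr (1 / l) * w X))"
      using P w0 by (intro sum_mono2) auto
    also have "\<dots> = exp (-s) * (\<Sum>X\<in>Pow P. \<Prod>p\<in>X. real p powr (1 / l) * (real k / real p))"
      unfolding sum_distrib_left
    proof (rule sum.cong[OF refl])
      fix X assume "X \<in> Pow P"
      show "exp (-s) * (real (\<Prod>X) powr (1 / l) * w X) =
          exp (-s) * (\<Prod>p\<in>X. real p powr (1 / l) * (real k / real p))"
        by (simp add: w prod.distrib prod_powr_distrib del: times_divide_eq_right)
    qed
    also have "(\<Sum>X\<in>Pow P. \<Prod>p\<in>X. real p powr (1 / l) * (real k / real p)) =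
        (\<Prod>p\<in>P. 1 + real p powr (1 / l) * (real k / real p))"
      using P by (simp add: prod_one_plus_eq_sum_subsets)
    also have "\<dots> \<le> (\<Prod>p\<in>P. (1 + real k / real p) * exp (real k * exp 1 / l * (ln (real p) / real p)))"
    proof (intro prod_mono conjI)
      fix p assume p: "p \<in> P"
      then have p2: "real p \<ge> 2" by (rule P)
      have lp: "0 \<le> ln (real p) / l" "ln (real p) / l \<le> 1"
        using p p2 l by (auto simp: P_def log_primes_def)
      have "real p powr (1 / l) = exp (ln (real p) / l)" using p2 by (simp add: powr_def)
      also have "\<dots> \<le> 1 + ln (real p) / l * exp 1" using lp by (rule exp_le_one_plus_mult)
      finally have "1 + real p powr (1 / l) * (real k / real p) \<le>
          1 + (1 + ln (real p) / l * exp 1) * (real k / real p)"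
        using p2 by (intro add_left_mono mult_right_mono) auto
      also have "\<dots> = 1 + real k / real p + 1 * (real k * exp 1 / l * (ln (real p) / real p))"
        by (simp add: algebra_simps)
      \<comment> \<open>Enlarging the last term by 1 + k/p makes the expression factor, which
        separates T from the correction.\<close>
      also have "\<dots> \<le> 1 + real k / real p + (1 + real k / real p) * (real k * exp 1 / l * (ln (real p) / real p))"
        using p2 l by (intro add_left_mono mult_right_mono mult_nonneg_nonneg divide_nonneg_nonneg) auto
      also have "\<dots> = (1 + real k / real p) * (1 + real k * exp 1 / l * (ln (real p) / real p))"
        by (simp add: algebra_simps)
      also have "\<dots> \<le> (1 + real k / real p) * exp (real k * exp 1 / l * (ln (real p) / real p))"
        by (intro mult_left_mono exp_ge_add_one_self) auto
      finally show "1 + real p powr (1 / l) * (real k / real p) \<le>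
          (1 + real k / real p) * exp (real k * exp 1 / l * (ln (real p) / real p))" .
    qed auto
    also have "\<dots> = T * exp (real k * exp 1 / l * (\<Sum>p\<in>P. ln (real p) / real p))"
      using P by (simp add: T_def prod.distrib exp_sum sum_distrib_left)
    also have "\<dots> \<le> T * exp (real k * exp 1 / l * (2 * l))"
    proof (rule mult_left_mono)
      have "real k * exp 1 / l * (\<Sum>p\<in>P. ln (real p) / real p) \<le> real k * exp 1 / l * (2 * l)"
        using sum_ln_over_primes_le[of l] l by (intro mult_left_mono) (auto simp: P_def)
      then show "exp (real k * exp 1 / l * (\<Sum>p\<in>P. ln (real p) / real p)) \<le> exp (real k * exp 1 / l * (2 * l))"
        by (simp only: exp_le_cancel_iff)
      show "0 \<le> T" using w0 by (simp add: T sum_nonneg)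
    qed
    finally have "(\<Sum>X\<in>{X\<in>Pow P. real (\<Prod>X) > exp (s * l)}. w X)
        \<le> exp (-s) * (T * exp (2 * (real k * exp 1)))"
      using l by (simp add: mult_ac)
    also have "\<dots> = T * exp (-1)"
      by (simp add: s_def flip: exp_add)
    also have "\<dots> \<le> T * (1 / 2)"
    proof (rule mult_left_mono)
      show "exp (-1) \<le> (1 / 2 :: real)" using exp_ge_add_one_self[of 1] by (simp add: exp_minus field_simps)
      show "0 \<le> T" using w0 by (simp add: T sum_nonneg)
    qed
    finally have tail: "(\<Sum>X\<in>{X\<in>Pow P. real (\<Prod>X) > exp (s * l)}. w X) \<le> T / 2" by simp
    have "Pow P = {X. X \<subseteq> P \<and> real (\<Prod>X) \<le> exp (s * l)} \<union> {X\<in>Pow P. real (\<Prod>X) > exp (s * l)}"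
      by auto
    then have "T = (\<Sum>X\<in>{X. X \<subseteq> P \<and> real (\<Prod>X) \<le> exp (s * l)} \<union> {X\<in>Pow P. real (\<Prod>X) > exp (s * l)}. w X)"
      by (simp only: T)
    also have "\<dots> = (\<Sum>X | X \<subseteq> P \<and> real (\<Prod>X) \<le> exp (s * l). w X) +
        (\<Sum>X\<in>{X\<in>Pow P. real (\<Prod>X) > exp (s * l)}. w X)"
      using P by (intro sum.union_disjoint) auto
    finally have main: "T / 2 \<le> (\<Sum>X | X \<subseteq> P \<and> real (\<Prod>X) \<le> exp (s * l). w X)"
      using tail by simp
    \<comment> \<open>Lower bound for T: its logarithm is at least k times the sum of 1/p minus k^2
      times the bounded sum of 1/p^2, and the first sum is at least ln l - C.\<close>
    have "(\<Sum>p\<in>P. (1 / real p) ^ 2) \<le> (\<Sum>p\<in>P. real p powr (-3/2))"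
      using P(3) by (intro sum_mono) (use inverse_square_le_powr in \<open>force simp: power_divide\<close>)
    also have "\<dots> \<le> Z" using P by (intro Z)
    finally have "real k * (ln l - C) - real k ^ 2 * Z \<le>
        real k * (\<Sum>p\<in>P. 1 / real p) - real k ^ 2 * (\<Sum>p\<in>P. (1 / real p) ^ 2)"
      using C[OF l] by (intro diff_mono mult_left_mono) (auto simp: P_def)
    also have "\<dots> = (\<Sum>p\<in>P. real k / real p - (real k / real p) ^ 2)"
      by (simp add: sum_subtractf sum_distrib_left power_divide)
    finally have "exp (real k * (ln l - C) - real k ^ 2 * Z) \<le> exp (\<Sum>p\<in>P. real k / real p - (real k / real p) ^ 2)"
      by simp
    also have "\<dots> = (\<Prod>p\<in>P. exp (real k / real p - (real k / real p) ^ 2))"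
      using P by (simp add: exp_sum)
    also have "\<dots> \<le> T" unfolding T_def
      by (intro prod_mono conjI exp_minus_square_le) auto
    finally have "exp (real k * ln l) * exp (- real k * C - real k ^ 2 * Z) \<le> T"
      by (simp add: algebra_simps flip: exp_add)
    moreover have "exp (real k * ln l) = l ^ k" using l by (simp add: exp_of_nat_mult)
    ultimately have "D * l ^ k \<le> T / 2" by (simp add: D_def mult_ac)
    with main show ?thesis by (simp add: P_def w_def)
  qed
  moreover have "D > 0" "s > 0" by (auto simp: D_def s_def add_nonneg_pos)
  ultimately show ?thesis by blast
qed

text \<open>Only sets of primes dividing \<open>n\<close> occur. With w such primes in
  \<open>P\<close>, the binomial expansion gives (1 + (2^r - 1))^w = (2^w)^r, and \<open>n\<close>
  has at least 2^w divisors. This identity is the origin of the exponent 2^r - 1.\<close>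

lemma sum_subsets_le_num_divisors_power:
  assumes "n > 0" "finite P" "\<And>p. p \<in> P \<Longrightarrow> prime p"
  shows "(\<Sum>X | X \<subseteq> P \<and> \<Prod>X dvd n. real ((2 ^ r - 1) ^ card X)) \<le> real (num_divisors n) ^ r"
proof -
  define Q where "Q = P \<inter> prime_factors n"
  have Q: "finite Q" using assms by (simp add: Q_def)
  have "X \<subseteq> Q" if "X \<subseteq> P" "\<Prod>X dvd n" for X
  proof
    fix p assume p: "p \<in> X"
    have "finite X" using that assms finite_subset by blast
    then have "p dvd \<Prod>X" using p by (intro dvd_prodI) auto
    then have "p dvd n" using that dvd_trans by blast
    with p that assms show "p \<in> Q" by (auto simp: Q_def prime_factors_dvd)
  qed
  then have "(\<Sum>X | X \<subseteq> P \<and> \<Prod>X dvd n. real ((2 ^ r - 1) ^ card X)) \<le> (\<Sum>X\<in>Pow Q. real ((2 ^ r - 1) ^ card X))"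
    using Q by (intro sum_mono2) auto
  also have "\<dots> = (\<Prod>p\<in>Q. 1 + real (2 ^ r - 1))"
    unfolding prod_one_plus_eq_sum_subsets[OF Q] by simp
  also have "\<dots> = real ((2 ^ card Q) ^ r)"
    by (simp add: of_nat_diff power_mult[symmetric] mult.commute)
  also have "\<dots> \<le> real (num_divisors n ^ r)"
    using two_power_primes_le_num_divisors[of n Q] assms
    by (intro of_nat_mono power_mono) (auto simp: Q_def)
  finally show ?thesis by simp
qed

lemma pi_count_eq_card_dvd: "pi_count A n x d = card {a \<in> A x. d dvd n a}"
  by (simp add: pi_count_def cong_0_iff)

lemma divisor_moment_lower_bound:
  assumes "c > 0" "K > 0"
  shows "\<exists>C>0. \<forall>(A :: real \<Rightarrow> 'a set) n.
        admissible_family A n \<and> L c K A n \<longrightarrow>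
        (\<forall>\<^sub>F x in at_top. (\<Sum>a\<in>A x. real (num_divisors (n a)) ^ r)
                  \<ge> C * (real (card (A x)) * ln x ^ (2 ^ r - 1)))"
proof -
  define k :: nat where "k = 2 ^ r - 1"
  obtain D s where Ds: "D > 0" "s > 0" "\<And>l. l > 0 \<Longrightarrow>
      D * l ^ k \<le> (\<Sum>X | X \<subseteq> log_primes l \<and> real (\<Prod>X) \<le> exp (s * l). real (k ^ card X) / real (\<Prod>X))"
    using sum_squarefree_ge[of k] by blast
  define C where "C = K * D * (c / s) ^ k"
  have "\<forall>\<^sub>F x in at_top. (\<Sum>a\<in>A x. real (num_divisors (n a)) ^ r) \<ge> C * (real (card (A x)) * ln x ^ k)"
    if An: "admissible_family A n" "L c K A n" for A :: "real \<Rightarrow> 'a set" and n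
    using An(2)[unfolded L_def] eventually_gt_at_top[of 1]
  proof eventually_elim
    case (elim x)
    have fin: "finite (A x)" and n0: "\<And>a. a \<in> A x \<Longrightarrow> n a > 0"
      using An(1) elim(2) by (force simp: admissible_family_def)+
    \<comment> \<open>With this level e^(sl) equals x^c, so the hypothesis on
      \<open>pi_count\<close> covers every product that is kept.\<close>
    define l where "l = c / s * ln x"
    define P where "P = log_primes l"
    define \<X> where "\<X> = {X. X \<subseteq> P \<and> real (\<Prod>X) \<le> exp (s * l)}"
    have l: "l > 0" using assms elim(2) Ds by (simp add: l_def)
    have P: "finite P" "\<And>p. p \<in> P \<Longrightarrow> prime p"
      using finite_log_primes prime_log_primes by (auto simp: P_def)
    have X: "finite \<X>" using P by (auto simp: \<X>_def)
    have y: "exp (s * l) = x powr c" using Ds elim(2) by (simp add: l_def powr_def)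
    have "C * (real (card (A x)) * ln x ^ k) = K * real (card (A x)) * (D * l ^ k)"
      by (simp add: C_def l_def power_mult_distrib power_divide)
    also have "\<dots> \<le> K * real (card (A x)) * (\<Sum>X\<in>\<X>. real (k ^ card X) / real (\<Prod>X))"
      using Ds(3)[OF l] assms by (intro mult_left_mono) (auto simp: \<X>_def P_def)
    also have "\<dots> = (\<Sum>X\<in>\<X>. real (k ^ card X) * (K * (1 / real (\<Prod>X) * real (card (A x)))))"
      by (simp add: sum_distrib_left mult_ac)
    also have "\<dots> \<le> (\<Sum>X\<in>\<X>. real (k ^ card X) * real (pi_count A n x (\<Prod>X)))"
    proof (intro sum_mono mult_left_mono)
      fix X assume "X \<in> \<X>"
      then have X: "X \<subseteq> P" "real (\<Prod>X) \<le> x powr c" by (auto simp: \<X>_def y)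
      have "\<Prod>X > 0" using X P by (intro prod_pos) (auto intro!: prime_gt_0_nat)
      then show "K * (1 / real (\<Prod>X) * real (card (A x))) \<le> real (pi_count A n x (\<Prod>X))"
        using elim(1) X(2) Suc_leI by (metis One_nat_def)
    qed auto
    also have "\<dots> = (\<Sum>X\<in>\<X>. \<Sum>a | a \<in> A x \<and> \<Prod>X dvd n a. real (k ^ card X))"
      by (simp add: pi_count_eq_card_dvd mult_ac)
    also have "\<dots> = (\<Sum>a\<in>A x. \<Sum>X | X \<in> \<X> \<and> \<Prod>X dvd n a. real (k ^ card X))"
      by (rule sum.swap_restrict[OF X fin])
    also have "\<dots> \<le> (\<Sum>a\<in>A x. real (num_divisors (n a)) ^ r)"
    proof (rule sum_mono)
      fix a assume a: "a \<in> A x"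
      have "(\<Sum>X | X \<in> \<X> \<and> \<Prod>X dvd n a. real (k ^ card X))
          \<le> (\<Sum>X | X \<subseteq> P \<and> \<Prod>X dvd n a. real (k ^ card X))"
        using P by (intro sum_mono2) (auto simp: \<X>_def)
      also have "\<dots> \<le> real (num_divisors (n a)) ^ r"
        unfolding k_def using n0[OF a] P by (rule sum_subsets_le_num_divisors_power)
      finally show "(\<Sum>X | X \<in> \<X> \<and> \<Prod>X dvd n a. real (k ^ card X)) \<le> real (num_divisors (n a)) ^ r" .
    qed
    finally show ?case .
  qed
  moreover have "C > 0" using assms Ds by (simp add: C_def)
  ultimately show ?thesis unfolding k_def by blast
qed

subsection \<open>The upper bound\<close>

lemma linear_le_exp:
  fixes e :: real
  assumes "e > 0"
  shows "real v + 1 \<le> (1 + 1 / e) * exp (e * real v)"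
proof -
  have "real v + 1 \<le> (1 + 1 / e) * (1 + e * real v)"
    using assms by (simp add: field_simps)
  also have "\<dots> \<le> (1 + 1 / e) * exp (e * real v)"
    using assms by (intro mult_left_mono exp_ge_add_one_self) auto
  finally show ?thesis .
qed

lemma summable_poly_geometric:
  fixes q :: real
  assumes "0 < q" "q < 1"
  shows "summable (\<lambda>v. (real v + 1) ^ r * q ^ v)"
proof -
  \<comment> \<open>Chosen so that r e + ln q = -e: the polynomial factor is absorbed by raising the
    ratio from q to e^(re) q = exp (-e), which is still below 1.\<close>
  define e where "e = - ln q / (real r + 1)"
  have e: "e > 0" unfolding e_def using assms by (intro divide_pos_pos) auto
  define D where "D = 1 + 1 / e"
  define g where "g = exp (real r * e) * q"
  have "real r * e + ln q = - e"
    by (simp add: e_def field_simps)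
  moreover have "g = exp (real r * e + ln q)" using assms by (simp add: g_def exp_add)
  ultimately have "g = exp (- e)" by simp
  then have g: "0 < g" "g < 1" using e by auto
  have bound: "norm ((real v + 1) ^ r * q ^ v) \<le> D ^ r * g ^ v" for v
  proof -
    have "(real v + 1) ^ r \<le> (D * exp (e * real v)) ^ r"
      unfolding D_def using e by (intro power_mono linear_le_exp) auto
    also have "\<dots> = D ^ r * exp (real r * e) ^ v"
      by (simp add: power_mult_distrib mult_ac flip: exp_of_nat_mult)
    finally show ?thesis
      using assms by (simp add: g_def power_mult_distrib mult_right_mono flip: mult.assoc)
  qed
  have "summable (\<lambda>v. D ^ r * g ^ v)"
    using g by (intro summable_mult summable_geometric) simp
  then show ?thesis by (rule summable_comparison_test') (rule bound)
qed

text \<open>Chosen so that its partial sums over \<open>v\<close> dominate \<open>(v + 1)\<^sup>r p\<^sup>e\<^sup>v\<close>, which makes the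
  divisor sums below majorise \<open>d(m)\<^sup>r m\<^sup>e\<close>; at \<open>v = 1\<close> it is \<open>2\<^sup>r - 1\<close> up to \<open>O(e ln p)\<close>.\<close>

definition rankin_weight :: "nat \<Rightarrow> real \<Rightarrow> nat \<Rightarrow> nat \<Rightarrow> real" where
  "rankin_weight r e p v =
     (if v = 0 then 1 else if v = 1 then 2 ^ r * real p powr e - 1
      else (real v + 1) ^ r * real p powr (e * real v))"

definition rankin_mult :: "nat \<Rightarrow> real \<Rightarrow> nat \<Rightarrow> real" where
  "rankin_mult r e n = (\<Prod>p\<in>prime_factors n. rankin_weight r e p (multiplicity p n))"

lemma rankin_weight_nonneg:
  assumes "prime p" "e \<ge> 0"
  shows "rankin_weight r e p v \<ge> 0"
proof -
  have "1 \<le> real p powr e" using assms prime_gt_0_nat[of p] by (intro ge_one_powr_ge_zero) auto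
  then have "1 * 1 \<le> 2 ^ r * real p powr e" by (intro mult_mono) auto
  then show ?thesis by (simp add: rankin_weight_def)
qed

lemma rankin_mult_nonneg: "e \<ge> 0 \<Longrightarrow> rankin_mult r e n \<ge> 0"
  unfolding rankin_mult_def by (intro prod_nonneg rankin_weight_nonneg) auto

lemma num_divisors_power_le_rankin:
  assumes "m > 0" "e \<ge> 0"
  shows "real (num_divisors m) ^ r * real m powr e \<le> (\<Sum>d | d dvd m. rankin_mult r e d)"
proof -
  have "real (num_divisors m) ^ r * real m powr e \<le>
      (\<Prod>p\<in>prime_factors m. real (multiplicity p m) + 1) ^ r *
      (\<Prod>p\<in>prime_factors m. real p ^ multiplicity p m) powr e"
    using assms num_divisors_le_prod[of m] prod_prime_powers_real[of m]
    by (intro mult_mono power_mono) (auto intro!: prod_nonneg)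
  also have "\<dots> = (\<Prod>p\<in>prime_factors m. (real (multiplicity p m) + 1) ^ r * (real p ^ multiplicity p m) powr e)"
    by (simp add: prod_power_distrib prod_powr_distrib prod.distrib)
  also have "\<dots> \<le> (\<Prod>p\<in>prime_factors m. \<Sum>v\<le>multiplicity p m. rankin_weight r e p v)"
  proof (intro prod_mono conjI)
    fix p assume "p \<in> prime_factors m"
    then have p: "prime p" "multiplicity p m > 0" by (auto simp: prime_factors_multiplicity)
    have eq: "(real p ^ v) powr e = real p powr (e * real v)" for v
      using prime_gt_0_nat[OF p(1)] by (simp add: powr_powr mult.commute flip: powr_realpow)
    show "(real (multiplicity p m) + 1) ^ r * (real p ^ multiplicity p m) powr e \<le>
        (\<Sum>v\<le>multiplicity p m. rankin_weight r e p v)"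
    proof (cases "multiplicity p m = 1")
      case True
      then show ?thesis by (simp add: rankin_weight_def)
    next
      case False
      then have "(real (multiplicity p m) + 1) ^ r * (real p ^ multiplicity p m) powr e =
          rankin_weight r e p (multiplicity p m)"
        using p by (simp add: rankin_weight_def eq)
      also have "\<dots> \<le> (\<Sum>v\<le>multiplicity p m. rankin_weight r e p v)"
        using p assms by (intro member_le_sum rankin_weight_nonneg) auto
      finally show ?thesis .
    qed
  qed auto
  also have "\<dots> \<le> (\<Sum>d | d dvd m. rankin_mult r e d)"
    unfolding rankin_mult_def
    using assms by (intro prod_le_sum_divisors_multiplicative rankin_weight_nonneg) (auto simp: rankin_weight_def)
  finally show ?thesis .
qed

lemma num_divisors_le_powr:
  assumes "e > 0"
  shows "\<exists>C>0. \<forall>n>0. real (num_divisors n) \<le> C * real n powr e"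
proof -
  define B where "B = 1 + 1 / (e * ln 2)"
  have B: "B \<ge> 1" using assms by (simp add: B_def)
  define P where "P = log_primes (ln 2 / e)"
  have "real (num_divisors n) \<le> B ^ card P * real n powr e" if "n > 0" for n
  proof -
    define c where "c = (\<lambda>p. if p \<in> P then B else 1)"
    have "real (num_divisors n) \<le> (\<Prod>p\<in>prime_factors n. real (multiplicity p n) + 1)"
      using that by (rule num_divisors_le_prod)
    also have "\<dots> \<le> (\<Prod>p\<in>prime_factors n. c p * (real p ^ multiplicity p n) powr e)"
    proof (intro prod_mono conjI)
      fix p assume p: "p \<in> prime_factors n"
      define v where "v = multiplicity p n"
      have p2: "real p \<ge> 2" using p prime_ge_2_nat[of p] by auto
      have eq: "(real p ^ v) powr e = exp (real v * (e * ln (real p)))"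
        using p2 by (simp add: powr_def ln_realpow)
      show "real (multiplicity p n) + 1 \<le> c p * (real p ^ multiplicity p n) powr e"
      proof (cases "p \<in> P")
        case True
        have "real v + 1 \<le> B * exp ((e * ln 2) * real v)"
          unfolding B_def using assms by (intro linear_le_exp) auto
        also have "\<dots> \<le> B * exp (real v * (e * ln (real p)))"
          using B assms p2 by (intro mult_left_mono) (auto intro!: mult_left_mono simp: mult_ac)
        finally show ?thesis using True by (simp add: c_def eq[unfolded v_def] v_def)
      next
        case False
        then have "ln 2 \<le> e * ln (real p)"
          using p assms by (auto simp: P_def log_primes_def field_simps)
        then have "exp (real v * ln 2) \<le> exp (real v * (e * ln (real p)))"
          by (auto intro: mult_left_mono)
        moreover have "exp (real v * ln 2) = 2 ^ v" by (simp add: exp_of_nat_mult)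
        moreover have "real v + 1 \<le> 2 ^ v"
        proof -
          have "Suc v \<le> 2 ^ v" by (simp add: Suc_leI)
          then have "real (Suc v) \<le> real (2 ^ v)" by (rule of_nat_mono)
          then show ?thesis by simp
        qed
        ultimately have "real v + 1 \<le> exp (real v * (e * ln (real p)))" by linarith
        then show ?thesis using False by (simp add: c_def eq[unfolded v_def] v_def)
      qed
    qed auto
    also have "\<dots> = (\<Prod>p\<in>prime_factors n. c p) * real n powr e"
      using that by (simp add: prod.distrib prod_prime_powers_real flip: prod_powr_distrib)
    also have "(\<Prod>p\<in>prime_factors n. c p) = B ^ card (prime_factors n \<inter> P)"
      by (simp add: c_def prod.If_cases Int_def)
    also have "B ^ card (prime_factors n \<inter> P) * real n powr e \<le> B ^ card P * real n powr e"
      using B finite_log_primes by (intro mult_right_mono power_increasing card_mono) (auto simp: P_def)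
    finally show ?thesis .
  qed
  moreover have "B ^ card P > 0" using B by simp
  ultimately show ?thesis by blast
qed

lemma rankin_mult_over_totient:
  assumes "n > 0"
  shows "rankin_mult r e n / real (totient n) =
    (\<Prod>p\<in>prime_factors n. rankin_weight r e p (multiplicity p n) / real (totient (p ^ multiplicity p n)))"
proof -
  have "totient n = (\<Prod>p\<in>prime_factors n. totient (p ^ multiplicity p n))"
    unfolding totient_formula1[OF assms]
    by (intro prod.cong refl totient_prime_power[symmetric]) (auto simp: prime_factors_multiplicity)
  then show ?thesis by (simp add: rankin_mult_def prod_dividef)
qed

lemma rankin_local_bound:
  assumes "r \<ge> 1"
  shows "\<exists>E\<ge>0. \<forall>e l p V. 0 \<le> e \<longrightarrow> e \<le> 1/4 \<longrightarrow> e * l \<le> b \<longrightarrow> p \<in> log_primes l \<longrightarrow>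
    (\<Sum>v\<le>V. rankin_weight r e p v / real (totient (p ^ v))) \<le>
    1 + real (2 ^ r - 1) * (1 / real p) + 2 ^ (r + 1) * exp b * e * (ln (real p) / real p) + E * real p powr (-3/2)"
proof -
  define k where "k = real (2 ^ r - 1)"
  define q :: real where "q = 2 powr (-3/4)"
  have q: "0 < q" "q < 1" by (auto simp: q_def powr_less_one)
  define W where "W = (\<Sum>v. (real v + 1) ^ r * q ^ v)"
  have W: "(\<Sum>v\<in>S. (real v + 1) ^ r * q ^ v) \<le> W" if "finite S" for S
    unfolding W_def using that q by (intro sum_le_suminf summable_poly_geometric) auto
  define E where "E = 2 * k + 2 * 2 powr (3/2) * W"
  have k: "k = 2 ^ r - 1" by (simp add: k_def of_nat_diff)
  have k0: "k \<ge> 0" by (simp add: k_def)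
  have "W \<ge> 0" using W[of "{}"] by simp
  then have E0: "E \<ge> 0" using k0 by (simp add: E_def)
  have "(\<Sum>v\<le>V. rankin_weight r e p v / real (totient (p ^ v))) \<le>
    1 + k * (1 / real p) + 2 ^ (r + 1) * exp b * e * (ln (real p) / real p) + E * real p powr (-3/2)"
    if h: "0 \<le> e" "e \<le> 1/4" "e * l \<le> b" "p \<in> log_primes l" for e l p V
  proof -
    define P where "P = real p"
    define F where "F = (\<lambda>v. rankin_weight r e p v / real (totient (p ^ v)))"
    have p: "prime p" using h prime_log_primes by blast
    have P2: "P \<ge> 2" using h log_primes_gt_1 by (auto simp: P_def)
    have F0: "F v \<ge> 0" for v
      using rankin_weight_nonneg[OF p h(1)] by (simp add: F_def)
    have tot: "real (totient (p ^ v)) \<ge> P ^ v / 2" if "v > 0" for v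
    proof -
      have "real (totient (p ^ v)) = P ^ (v - 1) * (P - 1)"
        using p that prime_gt_0_nat[OF p] by (simp add: totient_prime_power P_def of_nat_diff)
      also have "\<dots> \<ge> P ^ (v - 1) * (P / 2)" using P2 by (intro mult_left_mono) auto
      also have "P ^ (v - 1) * (P / 2) = P ^ v / 2" using that by (cases v) auto
      finally show ?thesis .
    qed
    have a: "F 0 = 1" by (simp add: F_def rankin_weight_def)
    have b: "F 1 \<le> k / P + 2 * k * P powr (-3/2) + 2 ^ (r + 1) * exp b * e * (ln P / P)"
    proof -
      have lp: "ln P \<le> l" "0 \<le> ln P" using h P2 by (auto simp: P_def log_primes_def)
      have "e * ln P \<le> b" using mult_left_mono[OF lp(1) h(1)] h(3) by simp
      then have "exp (e * ln P) \<le> 1 + e * ln P * exp b"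
        using lp h by (intro exp_le_one_plus_mult) auto
      then have pe: "P powr e \<le> 1 + e * ln P * exp b" using P2 by (simp add: powr_def)
      have "F 1 = (2 ^ r * P powr e - 1) / (P - 1)"
        using p prime_gt_0_nat[OF p] by (simp add: F_def rankin_weight_def totient_prime P_def of_nat_diff)
      also have "\<dots> \<le> (2 ^ r * (1 + e * ln P * exp b) - 1) / (P - 1)"
        using P2 pe by (intro divide_right_mono diff_right_mono mult_left_mono) auto
      also have "\<dots> = k * (1 / (P - 1)) + 2 ^ r * (e * ln P * exp b) * (1 / (P - 1))"
        by (simp add: k algebra_simps add_divide_distrib[symmetric] diff_divide_distrib[symmetric])
      also have "\<dots> \<le> k * (1 / P + 2 * (1 / P ^ 2)) + 2 ^ r * (e * ln P * exp b) * (2 / P)"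
      proof (intro add_mono mult_left_mono)
        have "(1 / P + 2 * (1 / P ^ 2)) * (P - 1) - 1 = (P - 2) / P ^ 2"
          using P2 by (simp add: field_simps power2_eq_square)
        also have "\<dots> \<ge> 0" using P2 by simp
        finally show "1 / (P - 1) \<le> 1 / P + 2 * (1 / P ^ 2)" using P2 by (simp add: divide_le_eq)
        show "1 / (P - 1) \<le> 2 / P" using P2 by (simp add: field_simps)
      qed (use k0 h lp in auto)
      also have "\<dots> \<le> k * (1 / P + 2 * P powr (-3/2)) + 2 ^ r * (e * ln P * exp b) * (2 / P)"
        using inverse_square_le_powr[of p] k0 P2
        by (intro add_mono mult_left_mono order.refl) (auto simp: P_def)
      finally show ?thesis by (simp add: algebra_simps)
    qed
    have c: "F v \<le> (2 * 2 powr (3/2) * P powr (-3/2)) * ((real v + 1) ^ r * q ^ v)" if v: "v \<ge> 2" for v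
    proof -
      have "F v = (real v + 1) ^ r * P powr (e * real v) / real (totient (p ^ v))"
        using v by (simp add: F_def rankin_weight_def P_def)
      also have "\<dots> \<le> (real v + 1) ^ r * P powr (e * real v) / (P ^ v / 2)"
        using tot[of v] v P2 by (intro divide_left_mono mult_nonneg_nonneg mult_pos_pos) (auto simp: P_def)
      also have "\<dots> = 2 * (real v + 1) ^ r * P powr (e * real v - real v)"
        using P2 by (simp add: powr_diff powr_realpow)
      also have "\<dots> \<le> 2 * (real v + 1) ^ r * P powr (-3/2 + (-3/4) * (real v - 2))"
      proof (intro mult_left_mono powr_mono)
        have "e * real v \<le> 1/4 * real v" using h by (intro mult_right_mono) auto
        also have "\<dots> = -3/2 + (-3/4) * (real v - 2) + real v" by (simp add: field_simps)
        finally show "e * real v - real v \<le> -3/2 + (-3/4) * (real v - 2)" by simp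
      qed (use P2 in auto)
      also have "\<dots> = 2 * (real v + 1) ^ r * (P powr (-3/2) * P powr ((-3/4) * (real v - 2)))"
        using P2 by (simp only: powr_add)
      also have "\<dots> \<le> 2 * (real v + 1) ^ r * (P powr (-3/2) * 2 powr ((-3/4) * (real v - 2)))"
        using P2 v by (intro mult_left_mono powr_mono2') auto
      also have "2 powr ((-3/4) * (real v - 2)) = 2 powr (3/2 + (-3/4) * real v)"
        by (rule arg_cong[where f = "\<lambda>t. 2 powr t"]) (simp add: field_simps)
      also have "\<dots> = 2 powr (3/2) * q ^ v"
        unfolding powr_add by (simp add: q_def powr_powr flip: powr_realpow)
      finally show ?thesis by (simp add: mult_ac)
    qed
    have "(\<Sum>v\<le>V. F v) \<le> (\<Sum>v\<in>{0, 1} \<union> {2..V}. F v)"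
      using F0 by (intro sum_mono2) auto
    also have "\<dots> = F 0 + F 1 + (\<Sum>v=2..V. F v)"
      by (subst sum.union_disjoint) auto
    also have "(\<Sum>v=2..V. F v) \<le> (\<Sum>v=2..V. (2 * 2 powr (3/2) * P powr (-3/2)) * ((real v + 1) ^ r * q ^ v))"
      by (intro sum_mono c) auto
    also have "\<dots> = (2 * 2 powr (3/2) * P powr (-3/2)) * (\<Sum>v=2..V. (real v + 1) ^ r * q ^ v)"
      by (simp only: sum_distrib_left)
    also have "\<dots> \<le> (2 * 2 powr (3/2) * P powr (-3/2)) * W"
      by (intro mult_left_mono W) auto
    finally show ?thesis using a b unfolding F_def[symmetric] P_def[symmetric]
      by (simp add: E_def algebra_simps)
  qed
  then show ?thesis unfolding k_def using E0 by blast
qed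

lemma rankin_sum_le:
  assumes "r \<ge> 1" "b \<ge> 0"
  shows "\<exists>M>0. \<forall>e l S. 0 \<le> e \<longrightarrow> e \<le> 1/4 \<longrightarrow> 0 \<le> l \<longrightarrow> e * l \<le> b \<longrightarrow> finite S \<longrightarrow>
    (\<forall>n\<in>S. n > 0 \<and> prime_factors n \<subseteq> log_primes l) \<longrightarrow>
    (\<Sum>n\<in>S. rankin_mult r e n / real (totient n)) \<le> M * (1 + l) ^ (2 ^ r - 1)"
proof -
  define k :: nat where "k = 2 ^ r - 1"
  obtain Z where Z: "Z \<ge> 0" "\<And>S. finite S \<Longrightarrow> (\<Sum>n\<in>S. real n powr (-3/2)) \<le> Z"
    using sum_powr_three_halves_bounded by blast
  obtain C where C: "\<And>l. l \<ge> 0 \<Longrightarrow> (\<Sum>p\<in>log_primes l. 1 / real p) \<le> ln (1 + l) + C"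
    using sum_inverse_primes_le by blast
  obtain E where E: "E \<ge> 0" "\<And>e l p V. 0 \<le> e \<Longrightarrow> e \<le> 1/4 \<Longrightarrow> e * l \<le> b \<Longrightarrow> p \<in> log_primes l \<Longrightarrow>
    (\<Sum>v\<le>V. rankin_weight r e p v / real (totient (p ^ v))) \<le>
    1 + real k * (1 / real p) + 2 ^ (r + 1) * exp b * e * (ln (real p) / real p) + E * real p powr (-3/2)"
    using rankin_local_bound[OF assms(1), of b] unfolding k_def by blast
  define A where "A = 2 ^ (r + 1) * exp b"
  define M where "M = exp (real k * C + A * (2 * b) + E * Z)"
  have "(\<Sum>n\<in>S. rankin_mult r e n / real (totient n)) \<le> M * (1 + l) ^ k"
    if h: "0 \<le> e" "e \<le> 1/4" "0 \<le> l" "e * l \<le> b" "finite S"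
      "\<forall>n\<in>S. n > 0 \<and> prime_factors n \<subseteq> log_primes l" for e l S
  proof -
    define P where "P = log_primes l"
    define f where "f = (\<lambda>p. real k * (1 / real p) + A * e * (ln (real p) / real p) + E * real p powr (-3/2))"
    have P: "finite P" "\<And>p. p \<in> P \<Longrightarrow> prime p"
      using finite_log_primes prime_log_primes by (auto simp: P_def)
    have "(\<Sum>n\<in>S. rankin_mult r e n / real (totient n)) =
      (\<Sum>n\<in>S. \<Prod>p\<in>prime_factors n. rankin_weight r e p (multiplicity p n) / real (totient (p ^ multiplicity p n)))"
      using h by (intro sum.cong rankin_mult_over_totient) auto
    also have "\<dots> \<le> (\<Prod>p\<in>P. exp (f p))"
    proof (rule sum_multiplicative_le_prod_finite[where F = "\<lambda>p v. rankin_weight r e p v / real (totient (p ^ v))"])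
      fix p V assume p: "p \<in> P"
      have "(\<Sum>v\<le>V. rankin_weight r e p v / real (totient (p ^ v))) \<le> 1 + f p"
        using E(2)[OF h(1,2,4), of p V] p by (simp add: P_def f_def A_def)
      also have "\<dots> \<le> exp (f p)" by (rule exp_ge_add_one_self)
      finally show "(\<Sum>v\<le>V. rankin_weight r e p v / real (totient (p ^ v))) \<le> exp (f p)" .
    qed (use P h in \<open>auto simp: rankin_weight_nonneg P_def rankin_weight_def[of r e _ 0]\<close>)
    also have "\<dots> = exp (\<Sum>p\<in>P. f p)" using P by (simp add: exp_sum)
    also have "\<dots> \<le> exp (real k * ln (1 + l) + (real k * C + A * (2 * b) + E * Z))"
    proof -
      have "(\<Sum>p\<in>P. f p) = real k * (\<Sum>p\<in>P. 1 / real p) + A * (e * (\<Sum>p\<in>P. ln (real p) / real p)) + E * (\<Sum>p\<in>P. real p powr (-3/2))"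
        by (simp add: f_def sum.distrib sum_distrib_left mult_ac)
      also have "\<dots> \<le> real k * (ln (1 + l) + C) + A * (2 * b) + E * Z"
      proof (intro add_mono mult_left_mono)
        show "(\<Sum>p\<in>P. 1 / real p) \<le> ln (1 + l) + C" using C h by (simp add: P_def)
        have "e * (\<Sum>p\<in>P. ln (real p) / real p) \<le> e * (2 * l)"
          unfolding P_def using h by (intro mult_left_mono sum_ln_over_primes_le) auto
        then show "e * (\<Sum>p\<in>P. ln (real p) / real p) \<le> 2 * b" using h by simp
      qed (use E P Z in \<open>auto simp: A_def\<close>)
      finally show ?thesis by (simp add: algebra_simps)
    qed
    also have "\<dots> = (1 + l) ^ k * M"
      using h by (simp add: M_def exp_add exp_of_nat_mult)
    finally show ?thesis by (simp add: mult.commute)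
  qed
  moreover have "M > 0" by (simp add: M_def)
  ultimately show ?thesis unfolding k_def by blast
qed

definition small_divisor_sum :: "nat \<Rightarrow> real \<Rightarrow> real \<Rightarrow> real \<Rightarrow> nat \<Rightarrow> real" where
  "small_divisor_sum r e l y n =
     (\<Sum>d | d dvd n \<and> real d \<le> y \<and> prime_factors d \<subseteq> log_primes l. rankin_mult r e d)"

lemma small_divisor_sum_nonneg: "e \<ge> 0 \<Longrightarrow> small_divisor_sum r e l y n \<ge> 0"
  unfolding small_divisor_sum_def by (intro sum_nonneg rankin_mult_nonneg)

lemma log_primes_mono: "l \<le> l' \<Longrightarrow> log_primes l \<subseteq> log_primes l'"
  by (auto simp: log_primes_def)

lemma num_divisors_power_le_small_divisor_sum:
  assumes "n > 0" "m dvd n" "real m \<le> y" "prime_factors m \<subseteq> log_primes l" "e \<ge> 0"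
  shows "real (num_divisors m) ^ r * real m powr e \<le> small_divisor_sum r e l y n"
proof -
  have m: "m > 0" using assms dvd_pos_nat by blast
  have "real (num_divisors m) ^ r * real m powr e \<le> (\<Sum>d | d dvd m. rankin_mult r e d)"
    using m assms by (intro num_divisors_power_le_rankin)
  also have "\<dots> \<le> small_divisor_sum r e l y n"
    unfolding small_divisor_sum_def
  proof (rule sum_mono2)
    show "finite {d. d dvd n \<and> real d \<le> y \<and> prime_factors d \<subseteq> log_primes l}"
      using assms by auto
    show "{d. d dvd m} \<subseteq> {d. d dvd n \<and> real d \<le> y \<and> prime_factors d \<subseteq> log_primes l}"
    proof
      fix d assume "d \<in> {d. d dvd m}"
      then have d: "d dvd m" by simp
      then have "d \<le> m" using m by (intro dvd_imp_le)
      moreover have "prime_factors d \<subseteq> prime_factors m" using d m by (intro dvd_prime_factors) auto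
      ultimately show "d \<in> {d. d dvd n \<and> real d \<le> y \<and> prime_factors d \<subseteq> log_primes l}"
        using assms d dvd_trans[OF d assms(2)] by auto
    qed
  qed (use assms in \<open>auto intro: rankin_mult_nonneg\<close>)
  finally show ?thesis .
qed

text \<open>Here \<open>X = e\<^sup>L\<close> bounds \<open>n\<close> and \<open>y = e\<^bsup>cL\<^esup>\<close>. If \<open>n = m b\<close> is split at the prime
  \<open>p\<close> with \<open>X\<^bsup>1/(s+1)\<^esup> < p \<le> X\<^bsup>1/s\<^esup>\<close>, then \<open>b\<close> has at most \<open>s\<close> prime factors, and the factor
  \<open>2\<^bsup>rs\<^esup>\<close> lost on them is regained from \<open>m\<^sup>e \<ge> (y/p)\<^sup>e\<close> with \<open>e = \<kappa>s/L\<close>.\<close>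

lemma num_divisors_power_le_sum_small_divisors:
  fixes c :: real
  assumes "0 < c" "r \<ge> 1"
  shows "\<exists>b>0. \<exists>D>0. \<forall>L n. 0 < L \<longrightarrow> n > 0 \<longrightarrow> ln (real n) < L \<longrightarrow>
    real (num_divisors n) ^ r \<le> D * (small_divisor_sum r 0 L (exp (c * L)) n
      + small_divisor_sum r (1/4) (4 * b) (exp (c * L)) n
      + (\<Sum>s=1..nat \<lfloor>L / (4 * b)\<rfloor>. (1/2) ^ s * small_divisor_sum r (b * real s / L) (L / real s) (exp (c * L)) n))"
proof -
  define b where "b = (real r + 1) * ln 2 / c"
  have b: "b > 0" using assms by (auto simp: b_def intro!: divide_pos_pos mult_pos_pos)
  have bc: "b * c = (real r + 1) * ln 2" using assms by (simp add: b_def)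
  define e0 where "e0 = c / (4 * real r)"
  have e0: "e0 > 0" using assms by (simp add: e0_def)
  obtain B where B: "B > 0" "\<And>n. n > 0 \<Longrightarrow> real (num_divisors n) \<le> B * real n powr e0"
    using num_divisors_le_powr[OF e0] by blast
  define D where "D = 1 + exp b + B ^ r * exp b"
  have D: "D \<ge> 1" "D \<ge> exp b" "D \<ge> B ^ r * exp b" using B by (auto simp: D_def)
  have "real (num_divisors n) ^ r \<le> D * (small_divisor_sum r 0 L (exp (c * L)) n
      + small_divisor_sum r (1/4) (4 * b) (exp (c * L)) n
      + (\<Sum>s=1..nat \<lfloor>L / (4 * b)\<rfloor>. (1/2) ^ s * small_divisor_sum r (b * real s / L) (L / real s) (exp (c * L)) n))"
    if L: "0 < L" and n: "n > 0" "ln (real n) < L" for L n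
  proof -
    define y where "y = exp (c * L)"
    define T where "T = (\<lambda>e l. small_divisor_sum r e l y n)"
    define S where "S = nat \<lfloor>L / (4 * b)\<rfloor>"
    define Q where "Q = (\<Sum>s=1..S. (1/2) ^ s * T (b * real s / L) (L / real s))"
    have T0: "T e l \<ge> 0" if "e \<ge> 0" for e l
      using that by (simp add: T_def small_divisor_sum_nonneg)
    have Q0: "Q \<ge> 0" unfolding Q_def using b L by (intro sum_nonneg mult_nonneg_nonneg T0) auto
    have y1: "y \<ge> 1" using assms L by (simp add: y_def)
    have "real (num_divisors n) ^ r \<le> D * T 0 L \<or> real (num_divisors n) ^ r \<le> D * T (1/4) (4 * b)
        \<or> real (num_divisors n) ^ r \<le> D * Q"
    proof (cases "real n \<le> y")
      case True
      have "prime_factors n \<subseteq> log_primes L"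
      proof
        fix p assume p: "p \<in> prime_factors n"
        then have "p \<le> n" "p > 0" using n dvd_imp_le[of p n] prime_gt_0_nat[of p] by auto
        then have "ln (real p) \<le> ln (real n)" by simp
        with p n show "p \<in> log_primes L" by (auto simp: log_primes_def)
      qed
      then have "real (num_divisors n) ^ r * real n powr 0 \<le> T 0 L"
        unfolding T_def using n True by (intro num_divisors_power_le_small_divisor_sum) auto
      also have "\<dots> \<le> D * T 0 L" using D(1) T0[of 0 L] mult_right_mono[of 1 D "T 0 L"] by simp
      finally show ?thesis using n by simp
    next
      case False
      then obtain m f p where
        *: "n = m * f" "prime p" "p dvd f" "real m \<le> y" "y < real (m * p)"
          "\<And>q. prime q \<Longrightarrow> q dvd m \<Longrightarrow> q \<le> p" "\<And>q. prime q \<Longrightarrow> q dvd f \<Longrightarrow> p \<le> q"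
        using ordered_factor_split[of n y] n y1 by (auto simp: not_le)
      have pos: "m > 0" "f > 0" using * n by auto
      have p2: "real p \<ge> 2" using prime_ge_2_nat[OF *(2)] by simp
      define u where "u = ln (real p)"
      have u: "u > 0" using p2 by (simp add: u_def)
      have fn: "f \<le> n" using * pos by simp
      have "p \<le> f" using *(3) pos by (intro dvd_imp_le)
      then have "ln (real p) \<le> ln (real n)" using fn p2 by (subst ln_le_cancel_iff) auto
      then have uL: "u < L" using n by (simp add: u_def)
      define s where "s = nat \<lfloor>L / u\<rfloor>"
      have "L / u \<ge> 1" using uL u by simp
      then have s1: "s \<ge> 1" by (simp add: s_def le_nat_floor)
      have "real s \<le> L / u" using L u by (simp add: s_def)
      then have su: "real s * u \<le> L" using u by (simp add: field_simps)
      have sm: "prime_factors m \<subseteq> log_primes u"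
      proof
        fix q assume q: "q \<in> prime_factors m"
        then have "q \<le> p" "q > 0" using *(6) prime_gt_0_nat[of q] by auto
        then show "q \<in> log_primes u" using q by (auto simp: log_primes_def u_def)
      qed
      obtain t where t: "num_divisors f \<le> 2 ^ t" "p ^ t \<le> f"
        using num_divisors_rough[of f p] pos *(7) p2 by auto
      have "real t * u \<le> L"
      proof -
        have "real t * u = ln (real (p ^ t))" using p2 by (simp add: u_def ln_realpow)
        also have "\<dots> \<le> ln (real n)" using t fn p2 n(1) by (subst ln_le_cancel_iff) auto
        finally show ?thesis using n by simp
      qed
      then have "real t \<le> L / u" using u by (simp add: field_simps)
      then have ts: "t \<le> s" by (simp add: s_def le_nat_floor)
      have lm: "c * L - u < ln (real m)"
      proof -
        have "c * L = ln y" by (simp add: y_def)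
        also have "\<dots> < ln (real (m * p))" using * y1 by (subst ln_less_cancel_iff) auto
        also have "\<dots> = ln (real m) + u" using pos p2 by (simp add: u_def ln_mult)
        finally show ?thesis by simp
      qed
      have dm: "real (num_divisors m) ^ r \<ge> 1"
        using num_divisors_pos[OF pos(1)] by (intro one_le_power) simp
      show ?thesis
      proof (cases "b * real s / L \<le> 1/4")
        case True
        define e where "e = b * real s / L"
        have e: "e \<ge> 0" using b L by (simp add: e_def)
        have "num_divisors n \<le> num_divisors m * 2 ^ s"
        proof -
          have "num_divisors n \<le> num_divisors m * num_divisors f" using * num_divisors_mult_le by simp
          also have "\<dots> \<le> num_divisors m * 2 ^ s"
            using t ts by (intro mult_left_mono order.trans[OF t(1)] power_increasing) auto
          finally show ?thesis .
        qed
        then have "real (num_divisors n) \<le> real (num_divisors m * 2 ^ s)" by (rule of_nat_mono)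
        then have "real (num_divisors n) ^ r \<le> real (num_divisors m * 2 ^ s) ^ r" by (intro power_mono) auto
        also have "\<dots> = real (num_divisors m) ^ r * 2 ^ (s * r)"
          by (simp add: power_mult_distrib power_mult)
        also have "(2::real) ^ (s * r) = exp (b * c * real s) * (1/2) ^ s"
        proof -
          have "exp (b * c * real s) = exp (real (s * r + s) * ln 2)"
            by (simp add: bc algebra_simps)
          also have "\<dots> = 2 ^ (s * r + s)" by (subst exp_of_nat_mult) simp
          finally show ?thesis by (simp add: power_add power_one_over)
        qed
        also have "exp (b * c * real s) \<le> exp b * real m powr e"
        proof -
          have "e * u \<le> b" using su b L by (simp add: e_def field_simps)
          moreover have "e * (c * L) = b * c * real s" using L by (simp add: e_def)
          moreover have "e * (c * L - u) \<le> e * ln (real m)" using lm e by (intro mult_left_mono) auto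
          ultimately have "b * c * real s \<le> b + e * ln (real m)" by (simp only: right_diff_distrib)
          then have "exp (b * c * real s) \<le> exp (b + e * ln (real m))" by simp
          then show ?thesis using pos by (simp add: exp_add powr_def)
        qed
        finally have "real (num_divisors n) ^ r \<le> real (num_divisors m) ^ r * ((exp b * real m powr e) * (1/2) ^ s)"
          by (simp add: mult_left_mono mult_right_mono)
        then have "real (num_divisors n) ^ r \<le> exp b * ((1/2) ^ s * (real (num_divisors m) ^ r * real m powr e))"
          by (simp only: mult_ac)
        also have "\<dots> \<le> exp b * ((1/2) ^ s * T e (L / real s))"
        proof -
          have "log_primes u \<subseteq> log_primes (L / real s)"
            using su s1 by (intro log_primes_mono) (simp add: field_simps)
          then show ?thesis unfolding T_def
            using sm * n e by (intro mult_left_mono num_divisors_power_le_small_divisor_sum) auto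
        qed
        also have "(1/2) ^ s * T e (L / real s) \<le> Q"
        proof -
          have "real s \<le> L / (4 * b)" using True b L by (simp add: field_simps)
          then have "s \<in> {1..S}" using s1 by (simp add: S_def le_nat_floor)
          then show ?thesis unfolding Q_def e_def using b L
            by (intro member_le_sum[of s "{1..S}" "\<lambda>s. (1/2) ^ s * T (b * real s / L) (L / real s)"]
                mult_nonneg_nonneg T0) auto
        qed
        also have "exp b * Q \<le> D * Q" using D Q0 by (intro mult_right_mono)
        finally show ?thesis by simp
      next
        case False
        then have "L / real s < 4 * b" using s1 L by (simp add: field_simps)
        moreover have "u \<le> L / real s" using su s1 by (simp add: field_simps)
        ultimately have u4: "u \<le> 4 * b" by linarith
        have "real (num_divisors n) ^ r \<le> (B * real n powr e0) ^ r"
          using B(2) n by (intro power_mono) auto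
        also have "\<dots> = B ^ r * real n powr (c / 4)"
          using n assms by (simp add: power_mult_distrib e0_def powr_powr flip: powr_realpow)
        also have "real n powr (c / 4) \<le> exp b * real m powr (1/4)"
        proof -
          have "c / 4 * ln (real n) \<le> c / 4 * L" using n assms by (intro mult_left_mono) auto
          then have "c / 4 * ln (real n) \<le> b + 1/4 * ln (real m)" using lm u4 by simp
          then have "exp (c / 4 * ln (real n)) \<le> exp (b + 1/4 * ln (real m))" by simp
          then show ?thesis using n pos by (simp add: powr_def exp_add)
        qed
        finally have "real (num_divisors n) ^ r \<le> (B ^ r * exp b) * (1 * real m powr (1/4))"
          using B by (simp add: mult_left_mono mult_ac)
        also have "\<dots> \<le> (B ^ r * exp b) * (real (num_divisors m) ^ r * real m powr (1/4))"
          using B dm by (intro mult_left_mono mult_right_mono) auto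
        also have "\<dots> \<le> (B ^ r * exp b) * T (1/4) (4 * b)"
          unfolding T_def using sm * n B log_primes_mono[OF u4]
          by (intro mult_left_mono num_divisors_power_le_small_divisor_sum) auto
        also have "\<dots> \<le> D * T (1/4) (4 * b)" using D T0 by (intro mult_right_mono) auto
        finally show ?thesis by simp
      qed
    qed
    moreover have "0 \<le> D * T 0 L" "0 \<le> D * T (1/4) (4 * b)" "0 \<le> D * Q"
      using D T0 Q0 by auto
    ultimately have "real (num_divisors n) ^ r \<le> D * T 0 L + D * T (1/4) (4 * b) + D * Q"
      by linarith
    then show ?thesis by (simp add: T_def Q_def S_def y_def distrib_left)
  qed
  moreover have "D > 0" using D by simp
  ultimately show ?thesis using b by blast
qed

lemma sum_small_divisor_sum_le:
  assumes U: "U2 c K A n" and x: "x > 0" and fin: "finite (A x)" and n: "\<And>a. a \<in> A x \<Longrightarrow> n a > 0"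
    and y: "y \<le> x powr c" and e: "e \<ge> 0" and K: "K > 0"
    and M: "\<And>S. finite S \<Longrightarrow> \<forall>n\<in>S. n > 0 \<and> prime_factors n \<subseteq> log_primes l \<Longrightarrow>
      (\<Sum>n\<in>S. rankin_mult r e n / real (totient n)) \<le> M"
  shows "(\<Sum>a\<in>A x. small_divisor_sum r e l y (n a)) \<le> K * real (card (A x)) * M"
proof -
  define S where "S = {d::nat. d > 0 \<and> real d \<le> y \<and> prime_factors d \<subseteq> log_primes l}"
  have "S \<subseteq> {..nat \<lfloor>y\<rfloor>}" by (auto simp: S_def le_nat_floor)
  then have S: "finite S" using finite_subset by blast
  have "(\<Sum>a\<in>A x. small_divisor_sum r e l y (n a)) =
      (\<Sum>a\<in>A x. \<Sum>d | d \<in> S \<and> d dvd n a. rankin_mult r e d)"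
    unfolding small_divisor_sum_def
    using n by (intro sum.cong refl) (auto simp: S_def intro: dvd_pos_nat)
  also have "\<dots> = (\<Sum>d\<in>S. \<Sum>a | a \<in> A x \<and> d dvd n a. rankin_mult r e d)"
    by (rule sum.swap_restrict[OF fin S])
  also have "\<dots> = (\<Sum>d\<in>S. rankin_mult r e d * real (pi_count A n x d))"
    by (simp add: pi_count_eq_card_dvd mult.commute)
  also have "\<dots> \<le> (\<Sum>d\<in>S. rankin_mult r e d * (K * (1 / real (totient d) * real (card (A x)))))"
    using U x y e unfolding U2_def S_def
    by (intro sum_mono mult_left_mono rankin_mult_nonneg) (auto simp: Suc_le_eq)
  also have "\<dots> = K * real (card (A x)) * (\<Sum>d\<in>S. rankin_mult r e d / real (totient d))"
    by (simp add: sum_distrib_left mult_ac)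
  also have "\<dots> \<le> K * real (card (A x)) * M"
    using K S by (intro mult_left_mono M) (auto simp: S_def)
  finally show ?thesis .
qed

lemma divisor_moment_upper_bound:
  fixes \<beta> c K x0 :: real
  assumes "r \<ge> 1" "\<beta> > 0" "c > 0" "K > 0" "x0 > 1"
  shows "\<exists>C>0. \<forall>(A :: real \<Rightarrow> 'a set) n.
        admissible_family A n \<and> U1 \<beta> A n \<and> U2 c K A n \<longrightarrow>
        (\<forall>x\<ge>x0. (\<Sum>a\<in>A x. real (num_divisors (n a)) ^ r)
                  \<le> C * (real (card (A x)) * ln x ^ (2 ^ r - 1)))"
proof -
  define k :: nat where "k = 2 ^ r - 1"
  define c' where "c' = c / \<beta>"
  have c': "c' > 0" using assms by (simp add: c'_def)
  obtain b D where b: "b > 0" and D: "D > 0" and pointwise: "\<And>L n. 0 < L \<Longrightarrow> n > 0 \<Longrightarrow> ln (real n) < L \<Longrightarrow>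
    real (num_divisors n) ^ r \<le> D * (small_divisor_sum r 0 L (exp (c' * L)) n
      + small_divisor_sum r (1/4) (4 * b) (exp (c' * L)) n
      + (\<Sum>s=1..nat \<lfloor>L / (4 * b)\<rfloor>. (1/2) ^ s * small_divisor_sum r (b * real s / L) (L / real s) (exp (c' * L)) n))"
    using num_divisors_power_le_sum_small_divisors[OF c' assms(1)] by blast
  obtain M where M: "M > 0" "\<And>e l S. 0 \<le> e \<Longrightarrow> e \<le> 1/4 \<Longrightarrow> 0 \<le> l \<Longrightarrow> e * l \<le> b \<Longrightarrow> finite S \<Longrightarrow>
    \<forall>n\<in>S. n > 0 \<and> prime_factors n \<subseteq> log_primes l \<Longrightarrow>
    (\<Sum>n\<in>S. rankin_mult r e n / real (totient n)) \<le> M * (1 + l) ^ k"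
    using rankin_sum_le[OF assms(1), of b] b unfolding k_def by (meson less_imp_le)
  define H where "H = (1 + 4 * b) * (1 / ln x0 + \<beta>)"
  define C where "C = 3 * D * K * M * H ^ k"
  have lx0: "ln x0 > 0" using assms by simp
  then have H: "H > 0" using b assms by (auto simp: H_def intro!: mult_pos_pos add_pos_pos)
  have "(\<Sum>a\<in>A x. real (num_divisors (n a)) ^ r) \<le> C * (real (card (A x)) * ln x ^ k)"
    if An: "admissible_family A n" "U1 \<beta> A n" "U2 c K A n" and x: "x \<ge> x0"
    for A :: "real \<Rightarrow> 'a set" and n x
  proof -
    have x1: "x > 1" using x assms by simp
    have fin: "finite (A x)" and n0: "\<And>a. a \<in> A x \<Longrightarrow> n a > 0"
      using An(1) x1 by (force simp: admissible_family_def)+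
    define L where "L = \<beta> * ln x"
    define y where "y = exp (c' * L)"
    define S where "S = nat \<lfloor>L / (4 * b)\<rfloor>"
    define R where "R = K * real (card (A x)) * (M * (H * ln x) ^ k)"
    have L: "L > 0" using x1 assms by (simp add: L_def)
    have y: "y \<le> x powr c" using x1 assms by (simp add: y_def c'_def L_def powr_def)
    have nL: "ln (real (n a)) < L" if "a \<in> A x" for a
    proof -
      have "real (n a) < x powr \<beta>" using An(2) that x1 unfolding U1_def by fastforce
      then have "ln (real (n a)) < ln (x powr \<beta>)" using n0[OF that] by (subst ln_less_cancel_iff) auto
      then show ?thesis using x1 by (simp add: L_def ln_powr)
    qed
    have HL: "(1 + 4 * b) * (1 + L) \<le> H * ln x"
    proof -
      have "1 \<le> ln x / ln x0" using x assms lx0 by simp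
      then have "1 + L \<le> (1 / ln x0 + \<beta>) * ln x" by (simp add: L_def algebra_simps)
      then have "(1 + 4 * b) * (1 + L) \<le> (1 + 4 * b) * ((1 / ln x0 + \<beta>) * ln x)"
        using b by (intro mult_left_mono) auto
      then show ?thesis by (simp add: H_def mult_ac)
    qed
    have main: "(\<Sum>a\<in>A x. small_divisor_sum r e l y (n a)) \<le> R"
      if el: "0 \<le> e" "e \<le> 1/4" "0 \<le> l" "e * l \<le> b" "l \<le> L \<or> l = 4 * b" for e l
    proof -
      have "1 + l \<le> (1 + 4 * b) * (1 + L)"
        using el b L by (auto simp: algebra_simps intro: add_nonneg_nonneg order.trans)
      then have l: "1 + l \<le> H * ln x" using HL by linarith
      show ?thesis unfolding R_def
      proof (rule sum_small_divisor_sum_le[OF An(3) _ fin n0 y el(1) assms(4)])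
        fix S :: "nat set" assume "finite S" "\<forall>n\<in>S. n > 0 \<and> prime_factors n \<subseteq> log_primes l"
        then have "(\<Sum>n\<in>S. rankin_mult r e n / real (totient n)) \<le> M * (1 + l) ^ k"
          using el by (intro M) auto
        also have "\<dots> \<le> M * (H * ln x) ^ k"
          using M(1) l el by (intro mult_left_mono power_mono) auto
        finally show "(\<Sum>n\<in>S. rankin_mult r e n / real (totient n)) \<le> M * (H * ln x) ^ k" .
      qed (use x1 in auto)
    qed
    have R: "R \<ge> 0" using assms M(1) H x1 by (simp add: R_def)
    have 1: "(\<Sum>a\<in>A x. small_divisor_sum r 0 L y (n a)) \<le> R"
      using L b by (intro main) auto
    have 2: "(\<Sum>a\<in>A x. small_divisor_sum r (1/4) (4 * b) y (n a)) \<le> R"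
      using b by (intro main) auto
    have "(\<Sum>a\<in>A x. \<Sum>s=1..S. (1/2) ^ s * small_divisor_sum r (b * real s / L) (L / real s) y (n a)) =
        (\<Sum>s=1..S. (1/2) ^ s * (\<Sum>a\<in>A x. small_divisor_sum r (b * real s / L) (L / real s) y (n a)))"
      by (subst sum.swap) (simp add: sum_distrib_left)
    also have "\<dots> \<le> (\<Sum>s=1..S. (1/2) ^ s * R)"
    proof (intro sum_mono mult_left_mono main)
      fix s assume s: "s \<in> {1..S}"
      then have "real s \<le> real S" by simp
      also have "\<dots> \<le> L / (4 * b)" using L b by (simp add: S_def)
      finally show "b * real s / L \<le> 1/4" using b L by (simp add: field_simps)
      show "L / real s \<le> L \<or> L / real s = 4 * b" using s L by (simp add: divide_le_eq)
    qed (use b L in auto)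
    also have "\<dots> = (\<Sum>s=1..S. (1/2) ^ s) * R" by (simp add: sum_distrib_right)
    also have "\<dots> \<le> 1 * R"
    proof (intro mult_right_mono R)
      have "(\<Sum>s=1..S. (1/2::real) ^ s) = 1 - (1/2) ^ S" by (induction S) (auto simp: field_simps)
      then show "(\<Sum>s=1..S. (1/2::real) ^ s) \<le> 1" by simp
    qed
    finally have 3: "(\<Sum>a\<in>A x. \<Sum>s=1..S. (1/2) ^ s * small_divisor_sum r (b * real s / L) (L / real s) y (n a)) \<le> R"
      by simp
    have "(\<Sum>a\<in>A x. real (num_divisors (n a)) ^ r) \<le> (\<Sum>a\<in>A x. D * (small_divisor_sum r 0 L y (n a)
      + small_divisor_sum r (1/4) (4 * b) y (n a)
      + (\<Sum>s=1..S. (1/2) ^ s * small_divisor_sum r (b * real s / L) (L / real s) y (n a))))"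
      unfolding y_def S_def using L n0 nL by (intro sum_mono pointwise)
    also have "\<dots> \<le> D * (R + R + R)"
      unfolding sum_distrib_left[symmetric] sum.distrib using 1 2 3 D by (intro mult_left_mono add_mono) auto
    also have "\<dots> = C * (real (card (A x)) * ln x ^ k)"
      by (simp add: R_def C_def power_mult_distrib mult_ac)
    finally show ?thesis .
  qed
  moreover have "C > 0" using D assms M(1) H by (simp add: C_def)
  ultimately show ?thesis unfolding k_def by blast
qed

theorem theorem1p2:
  fixes r :: nat
  assumes "r \<ge> 1"
  shows
    "(\<forall>\<beta>>0. \<forall>c\<^sub>0>0. \<forall>K>0. \<forall>x\<^sub>0>1. \<exists>C>0. \<forall>(A :: real \<Rightarrow> 'a set) n.
        admissible_family A n \<and> U1 \<beta> A n \<and> U2 c\<^sub>0 K A n \<longrightarrow>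
        (\<forall>x\<ge>x\<^sub>0. (\<Sum>a\<in>A x. real (num_divisors (n a)) ^ r)
                  \<le> C * (real (card (A x)) * ln x ^ (2 ^ r - 1))))
     \<and>
     (\<forall>c\<^sub>1>0. \<forall>K>0. \<exists>C>0. \<forall>(A :: real \<Rightarrow> 'a set) n.
        admissible_family A n \<and> L c\<^sub>1 K A n \<longrightarrow>
        (\<forall>\<^sub>F x in at_top. (\<Sum>a\<in>A x. real (num_divisors (n a)) ^ r)
                  \<ge> C * (real (card (A x)) * ln x ^ (2 ^ r - 1))))"
proof (intro conjI allI impI)
  fix \<beta> c\<^sub>0 K x\<^sub>0 :: real
  assume "\<beta> > 0" "c\<^sub>0 > 0" "K > 0" "x\<^sub>0 > 1"
  with assms show "\<exists>C>0. \<forall>(A :: real \<Rightarrow> 'a set) n.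
        admissible_family A n \<and> U1 \<beta> A n \<and> U2 c\<^sub>0 K A n \<longrightarrow>
        (\<forall>x\<ge>x\<^sub>0. (\<Sum>a\<in>A x. real (num_divisors (n a)) ^ r)
                  \<le> C * (real (card (A x)) * ln x ^ (2 ^ r - 1)))"
    by (rule divisor_moment_upper_bound)
next
  fix c\<^sub>1 K :: real
  assume "c\<^sub>1 > 0" "K > 0"
  then show "\<exists>C>0. \<forall>(A :: real \<Rightarrow> 'a set) n.
        admissible_family A n \<and> L c\<^sub>1 K A n \<longrightarrow>
        (\<forall>\<^sub>F x in at_top. (\<Sum>a\<in>A x. real (num_divisors (n a)) ^ r)
                  \<ge> C * (real (card (A x)) * ln x ^ (2 ^ r - 1)))"
    by (rule divisor_moment_lower_bound)
qed

end
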